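(* Let $\mu=x_0i+y_0j+z_0k\in\mathcal H$ with $m=N(\mu)$ squarefree, where exactly two of $x_0,y_0,z_0$ are equal to each other in absolute value. Let $R_\mu(\rho)$ be an ideal of $\mathcal O(\mu)$ with right pseudo generator $\rho$, and write $\mu'=\rho\mu\rho^{-1}=x_1i+y_1j+z_1k$. Then the ideal class $[R_\mu(\rho)]$ is ambiguous if and only if exactly two of $x_1,y_1,z_1$ are equal to each other in absolute value.
   Context: Quaternions with Hamilton multiplication, $\Re$, $N$, conjugate $\overline q$, $q^{-1}=\overline q/N(q)$. $\mathcal H$ = Hurwitz integral quaternions $(a+bi+cj+dk)/2$, $a,b,c,d\in\mathbb Z$ of equal parity. With $r=1$ if $m\not\equiv3\pmod4$, $r=2$ otherwise, and $\omega=(r-1+\mu)/r$, $\mathcal O(\mu)=\mathbb Z+\mathbb Z\omega$ is a commutative subring of $\mathcal H$ isomorphic to the maximal order of $\mathbb Q(\sqrt{-m})$. Every nonzero ideal of $\mathcal O(\mu)$ has $\mathbb Z$-basis $c[a,b+\omega]$ ($c,a>0$); its right pseudo generator is $c\cdot\gcd_r(a,b+\omega)$ (greatest-norm common right divisor in $\mathcal H$, unique up to a unit on the left), and $R_\mu(\rho)=\{\xi\rho:\xi\in\mathcal H,\ \xi\rho\in\mathcal O(\mu)\}$ is the ideal with right pseudo generator $\rho$. Two ideals $\mathfrak a,\mathfrak b$ are equivalent if $\alpha\mathfrak a=\beta\mathfrak b$ for some nonzero $\alpha,\beta\in\mathcal O(\mu)$; the class $[\mathfrak a]$ is ambiguous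 if $[\mathfrak a]=[\overline{\mathfrak a}]$, where $\overline{\mathfrak a}=\{\overline x:x\in\mathfrak a\}$. *)

theory Defs
  imports
    Complex_Main
    "HOL-Computational_Algebra.Squarefree"
    "HOL-Algebra.Ideal"
begin

datatype quat = Quat (qRe: real) (qI: real) (qJ: real) (qK: real)

definition quat_norm :: "quat \<Rightarrow> real" where
  "quat_norm q = (qRe q)\<^sup>2 + (qI q)\<^sup>2 + (qJ q)\<^sup>2 + (qK q)\<^sup>2"

definition quat_cnj :: "quat \<Rightarrow> quat" where
  "quat_cnj q = Quat (qRe q) (- qI q) (- qJ q) (- qK q)"

instantiation quat :: ring_1
begin

definition zero_quat :: quat where "0 = Quat 0 0 0 0"

definition one_quat :: quat where "1 = Quat 1 0 0 0"

definition uminus_quat :: "quat \<Rightarrow> quat" where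
  "- q = Quat (- qRe q) (- qI q) (- qJ q) (- qK q)"

definition plus_quat :: "quat \<Rightarrow> quat \<Rightarrow> quat" where
  "p + q = Quat (qRe p + qRe q) (qI p + qI q) (qJ p + qJ q) (qK p + qK q)"

definition minus_quat :: "quat \<Rightarrow> quat \<Rightarrow> quat" where
  "p - q = Quat (qRe p - qRe q) (qI p - qI q) (qJ p - qJ q) (qK p - qK q)"

definition times_quat :: "quat \<Rightarrow> quat \<Rightarrow> quat" where
  "p * q = Quat
     (qRe p * qRe q - qI p * qI q - qJ p * qJ q - qK p * qK q)
     (qRe p * qI q + qI p * qRe q + qJ p * qK q - qK p * qJ q)
     (qRe p * qJ q - qI p * qK q + qJ p * qRe q + qK p * qI q)
     (qRe p * qK q + qI p * qJ q - qJ p * qI q + qK p * qRe q)"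

instance
  by standard
    (simp_all add: zero_quat_def one_quat_def uminus_quat_def plus_quat_def
      minus_quat_def times_quat_def algebra_simps)

end

lemma quat_unit_mult:
  "Quat 0 1 0 0 * Quat 0 1 0 0 = - 1"
  "Quat 0 0 1 0 * Quat 0 0 1 0 = - 1"
  "Quat 0 0 0 1 * Quat 0 0 0 1 = - 1"
  "Quat 0 1 0 0 * Quat 0 0 1 0 = Quat 0 0 0 1"
  "Quat 0 0 1 0 * Quat 0 0 0 1 = Quat 0 1 0 0"
  "Quat 0 0 0 1 * Quat 0 1 0 0 = Quat 0 0 1 0"
  by (simp_all add: times_quat_def one_quat_def uminus_quat_def)

lemma quat_norm_eq_0_iff: "quat_norm q = 0 \<longleftrightarrow> q = 0"
  by (cases q)
    (auto simp: quat_norm_def zero_quat_def add_nonneg_eq_0_iff)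

instantiation quat :: division_ring
begin

definition inverse_quat :: "quat \<Rightarrow> quat" where
  "inverse q = Quat (qRe (quat_cnj q) / quat_norm q) (qI (quat_cnj q) / quat_norm q)
     (qJ (quat_cnj q) / quat_norm q) (qK (quat_cnj q) / quat_norm q)"

definition divide_quat where
  "p div q = p * inverse q" for p q :: quat

instance
proof
  fix q :: quat
  assume "q \<noteq> 0"
  then have "quat_norm q \<noteq> 0"
    by (simp add: quat_norm_eq_0_iff)
  then show "inverse q * q = 1" "q * inverse q = 1"
    by (simp_all add: times_quat_def one_quat_def inverse_quat_def quat_cnj_def
        divide_simps) (simp_all add: quat_norm_def power2_eq_square)
next
  show "p div q = p * inverse q" for p q :: quat
    by (simp add: divide_quat_def)
  show "inverse (0 :: quat) = 0"
    by (simp add: inverse_quat_def quat_cnj_def zero_quat_def)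
qed

end

definition hurwitz :: "quat set" where
  "hurwitz = {Quat (of_int a / 2) (of_int b / 2) (of_int c / 2) (of_int d / 2) | a b c d :: int.
     (even a \<longleftrightarrow> even b) \<and> (even a \<longleftrightarrow> even c) \<and> (even a \<longleftrightarrow> even d)}"

definition right_divisor :: "quat \<Rightarrow> quat \<Rightarrow> bool" where
  "right_divisor d x \<longleftrightarrow> d \<in> hurwitz \<and> (\<exists>q\<in>hurwitz. x = q * d)"

text \<open>A greatest common right divisor is only unique up to a unit on the left, so it is
  a relation.\<close>

definition is_right_gcd :: "quat \<Rightarrow> quat \<Rightarrow> quat \<Rightarrow> bool" where
  "is_right_gcd d x y \<longleftrightarrow> right_divisor d x \<and> right_divisor d y \<and>
     (\<forall>e. right_divisor e x \<and> right_divisor e y \<longrightarrow> quat_norm e \<le> quat_norm d)"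

text \<open>In what follows \<open>\<mu>\<close> is meant to be a purely imaginary Hurwitz quaternion; its norm
  is then an integer, so the floor below only changes the type.\<close>

definition denom :: "quat \<Rightarrow> nat" where
  "denom \<mu> = (if \<lfloor>quat_norm \<mu>\<rfloor> mod 4 = 3 then 2 else 1)"

definition omega :: "quat \<Rightarrow> quat" where
  "omega \<mu> = (of_nat (denom \<mu> - 1) + \<mu>) / of_nat (denom \<mu>)"

definition quad_order :: "quat \<Rightarrow> quat set" where
  "quad_order \<mu> = {of_int a + of_int b * omega \<mu> | a b :: int. True}"

definition quad_order_ring :: "quat \<Rightarrow> quat ring" where
  "quad_order_ring \<mu> =
     \<lparr>carrier = quad_order \<mu>, monoid.mult = (*), one = 1, ring.zero = 0, add = (+)\<rparr>"

definition nonzero_ideal :: "quat \<Rightarrow> quat set \<Rightarrow> bool" where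
  "nonzero_ideal \<mu> I \<longleftrightarrow> ideal I (quad_order_ring \<mu>) \<and> I \<noteq> {0}"

definition int_span2 :: "quat \<Rightarrow> quat \<Rightarrow> quat set" where
  "int_span2 x y = {of_int s * x + of_int t * y | s t :: int. True}"

text \<open>The two generators below are automatically linearly independent over the integers when
  \<open>\<mu>\<close> is nonzero and purely imaginary, since \<open>a\<close> and \<open>c\<close> are positive.\<close>

definition right_pseudo_generator :: "quat \<Rightarrow> quat set \<Rightarrow> quat \<Rightarrow> bool" where
  "right_pseudo_generator \<mu> I \<rho> \<longleftrightarrow> (\<exists>a b c :: int. \<exists>\<delta>. a > 0 \<and> c > 0 \<and>
     I = int_span2 (of_int c * of_int a) (of_int c * (of_int b + omega \<mu>)) \<and>
     is_right_gcd \<delta> (of_int a) (of_int b + omega \<mu>) \<and>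
     \<rho> = of_int c * \<delta>)"

definition R_ideal :: "quat \<Rightarrow> quat \<Rightarrow> quat set" where
  "R_ideal \<mu> \<rho> = {\<xi> * \<rho> | \<xi>. \<xi> \<in> hurwitz \<and> \<xi> * \<rho> \<in> quad_order \<mu>}"

definition ideal_equiv :: "quat \<Rightarrow> quat set \<Rightarrow> quat set \<Rightarrow> bool" where
  "ideal_equiv \<mu> I J \<longleftrightarrow> (\<exists>\<alpha>\<in>quad_order \<mu> - {0}. \<exists>\<beta>\<in>quad_order \<mu> - {0}.
     (\<lambda>x. \<alpha> * x) ` I = (\<lambda>x. \<beta> * x) ` J)"

definition ideal_class :: "quat \<Rightarrow> quat set \<Rightarrow> quat set set" where
  "ideal_class \<mu> I = {J. nonzero_ideal \<mu> J \<and> ideal_equiv \<mu> I J}"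

definition ambiguous_class :: "quat \<Rightarrow> quat set \<Rightarrow> bool" where
  "ambiguous_class \<mu> I \<longleftrightarrow> ideal_class \<mu> I = ideal_class \<mu> (quat_cnj ` I)"

definition exactly_two_abs_eq :: "real \<Rightarrow> real \<Rightarrow> real \<Rightarrow> bool" where
  "exactly_two_abs_eq x y z \<longleftrightarrow>
     (\<bar>x\<bar> = \<bar>y\<bar> \<and> \<bar>x\<bar> \<noteq> \<bar>z\<bar>) \<or> (\<bar>x\<bar> = \<bar>z\<bar> \<and> \<bar>x\<bar> \<noteq> \<bar>y\<bar>) \<or> (\<bar>y\<bar> = \<bar>z\<bar> \<and> \<bar>x\<bar> \<noteq> \<bar>y\<bar>)"

end

theory Submission
  imports Defs
begin

text \<open>
  Write \<open>H\<close> for the Hurwitz order and \<open>I = R\<^sub>\<mu>(\<rho>)\<close>, so that \<open>H I = H \<rho>\<close>. The squarefreeness of \<open>m\<close>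
  makes \<open>O(\<mu>)\<close> the full intersection of \<open>H\<close> with the centralizer of \<open>\<mu>\<close>, so \<open>I\<close> is recovered
  from \<open>H \<rho>\<close> by intersecting with that centralizer. As two coordinates of \<open>\<mu>\<close> agree up to
  sign, \<open>\<mu>\<close> is orthogonal to a face diagonal \<open>\<tau>\<close> such as \<open>i - j\<close>. Conjugation by \<open>\<tau>\<close> preserves
  \<open>H\<close> and restricts to the quaternion conjugation on the centralizer of \<open>\<mu>\<close>, hence \<open>cnj I\<close> has
  right pseudo generator \<open>\<tau> \<rho> \<tau>\<^sup>-\<^sup>1\<close>. Comparing generators, the class of \<open>I\<close> is ambiguous iff
  \<open>\<mu>' = \<rho> \<mu> \<rho>\<^sup>-\<^sup>1\<close> anticommutes with some \<open>\<epsilon> \<tau>\<close>, \<open>\<epsilon>\<close> a unit of \<open>H\<close>. Such elements have norm 2, and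
  those anticommuting with \<open>\<mu>'\<close> are pure, hence up to sign face diagonals orthogonal to \<open>\<mu>'\<close>; they
  exist iff two coordinates of \<open>\<mu>'\<close> agree in absolute value. All three agreeing would force
  \<open>m = 3\<close>, which is excluded by the hypothesis on \<open>\<mu>\<close>.
\<close>

subsection \<open>Quaternion arithmetic\<close>

lemma quat_eq_iff: "p = q \<longleftrightarrow> qRe p = qRe q \<and> qI p = qI q \<and> qJ p = qJ q \<and> qK p = qK q"
  by (cases p; cases q) simp

lemmas quat_arith = zero_quat_def one_quat_def uminus_quat_def plus_quat_def minus_quat_def
  times_quat_def quat_cnj_def

lemma of_nat_quat: "of_nat n = Quat (of_nat n) 0 0 0"
  by (induction n) (simp_all add: quat_arith)

lemma of_int_quat: "of_int n = Quat (of_int n) 0 0 0"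
  by (cases n rule: int_cases2) (simp_all add: of_nat_quat quat_arith)

lemma numeral_quat: "numeral n = Quat (numeral n) 0 0 0"
  using of_nat_quat[of "numeral n"] by simp

lemma quat_norm_mult: "quat_norm (p * q) = quat_norm p * quat_norm q"
  by (simp add: quat_norm_def times_quat_def power2_eq_square algebra_simps)

lemma quat_norm_nonneg: "quat_norm q \<ge> 0"
  by (simp add: quat_norm_def)

lemma quat_norm_cnj: "quat_norm (quat_cnj q) = quat_norm q"
  by (simp add: quat_norm_def quat_cnj_def)

lemma quat_cnj_cnj [simp]: "quat_cnj (quat_cnj q) = q"
  by (cases q) (simp add: quat_cnj_def)

lemma quat_cnj_mult: "quat_cnj (p * q) = quat_cnj q * quat_cnj p"
  by (simp add: quat_arith algebra_simps)

lemma quat_cnj_mult_self: "quat_cnj q * q = Quat (quat_norm q) 0 0 0"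
  by (simp add: quat_arith quat_norm_def power2_eq_square)

section \<open>Commutants and anticommuting elements of a pure quaternion\<close>

lemma commute_mult:
  fixes p q r :: "'a :: semigroup_mult"
  assumes "p * r = r * p" "q * r = r * q"
  shows "(p * q) * r = r * (p * q)"
  using assms by (metis mult.assoc)

lemma commute_inverse:
  fixes p r :: "'a :: division_ring"
  assumes "p * r = r * p" "p \<noteq> 0"
  shows "inverse p * r = r * inverse p"
  using assms by (metis mult.assoc left_inverse right_inverse mult_1_left mult_1_right)

text \<open>The commutator with a pure quaternion is twice the cross product of the vector parts, so
  it vanishes only if the vector part of \<open>q\<close> is parallel to the given nonzero
  vector.\<close>

lemma commute_pure_quatE:
  assumes "q * Quat 0 x y z = Quat 0 x y z * q" "Quat 0 x y z \<noteq> 0"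
  obtains t where "q = Quat (qRe q) (t * x) (t * y) (t * z)"
proof -
  define n where "n = x\<^sup>2 + y\<^sup>2 + z\<^sup>2"
  define s where "s = qI q * x + qJ q * y + qK q * z"
  have n: "n \<noteq> 0"
    using assms(2) by (auto simp: n_def zero_quat_def add_nonneg_eq_0_iff)
  have c: "qJ q * z = qK q * y" "qK q * x = qI q * z" "qI q * y = qJ q * x"
    using assms(1) by (simp_all add: times_quat_def mult.commute)
  have "qI q * n - s * x = (qI q * y - qJ q * x) * y - (qK q * x - qI q * z) * z"
    "qJ q * n - s * y = (qJ q * z - qK q * y) * z - (qI q * y - qJ q * x) * x"
    "qK q * n - s * z = (qK q * x - qI q * z) * x - (qJ q * z - qK q * y) * y"
    unfolding n_def s_def by (simp_all add: power2_eq_square algebra_simps)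
  then have "qI q * n = s * x" "qJ q * n = s * y" "qK q * n = s * z"
    by (simp_all only: c diff_self mult_zero_left right_minus_eq)
  then have "q = Quat (qRe q) (s / n * x) (s / n * y) (s / n * z)"
    using n by (simp add: quat_eq_iff field_simps)
  then show ?thesis
    using that by blast
qed

text \<open>Both factors lie in the real span of 1 and one nonzero pure quaternion, a copy of the
  complex numbers.\<close>

lemma commutant_pure_commutative:
  assumes "p * Quat 0 x y z = Quat 0 x y z * p" "q * Quat 0 x y z = Quat 0 x y z * q"
    "Quat 0 x y z \<noteq> 0"
  shows "p * q = q * p"
proof -
  obtain s where "p = Quat (qRe p) (s * x) (s * y) (s * z)"
    using commute_pure_quatE[OF assms(1,3)] .
  moreover obtain t where "q = Quat (qRe q) (t * x) (t * y) (t * z)"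
    using commute_pure_quatE[OF assms(2,3)] .
  moreover have "Quat a (s * x) (s * y) (s * z) * Quat b (t * x) (t * y) (t * z) =
      Quat b (t * x) (t * y) (t * z) * Quat a (s * x) (s * y) (s * z)" for a b
    by (simp add: times_quat_def algebra_simps)
  ultimately show ?thesis
    by metis
qed

lemma commute_cnj:
  assumes "p * Quat 0 x y z = Quat 0 x y z * p"
  shows "quat_cnj p * Quat 0 x y z = Quat 0 x y z * quat_cnj p"
  using assms by (simp add: quat_arith algebra_simps)

text \<open>The commutant of a nonzero pure v is R + R v. Conjugation fixes the reals and sends v to
  -v there, and so does moving \<open>\<tau>\<close> across.\<close>

lemma anticommute_commutant:
  assumes "p * Quat 0 x y z = Quat 0 x y z * p" "Quat 0 x y z \<noteq> 0"
    and "\<tau> * Quat 0 x y z = - (Quat 0 x y z * \<tau>)"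
  shows "\<tau> * p = quat_cnj p * \<tau>"
proof -
  obtain s where s: "p = Quat (qRe p) (s * x) (s * y) (s * z)"
    using commute_pure_quatE[OF assms(1,2)] .
  have p: "p = Quat (qRe p) 0 0 0 + Quat s 0 0 0 * Quat 0 x y z"
    and cnj: "quat_cnj p = Quat (qRe p) 0 0 0 - Quat s 0 0 0 * Quat 0 x y z"
    by (subst s, simp add: quat_arith)+
  have real: "\<tau> * Quat r 0 0 0 = Quat r 0 0 0 * \<tau>" for r
    by (simp add: times_quat_def)
  have "\<tau> * p = Quat (qRe p) 0 0 0 * \<tau> + Quat s 0 0 0 * (\<tau> * Quat 0 x y z)"
    by (subst p, simp only: distrib_left real mult.assoc[symmetric])
  also have "\<dots> = quat_cnj p * \<tau>"
    unfolding cnj assms(3) by (simp only: left_diff_distrib mult.assoc mult_minus_right add_uminus_conv_diff)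
  finally show ?thesis .
qed

text \<open>For pure v, qv + vq = 2 Re(q) v - 2 (q.v). The first term is pure and the second is
  real, so both must vanish.\<close>

lemma anticommute_pure_iff:
  assumes "Quat 0 x y z \<noteq> 0"
  shows "q * Quat 0 x y z = - (Quat 0 x y z * q) \<longleftrightarrow>
    qRe q = 0 \<and> qI q * x + qJ q * y + qK q * z = 0"
  using assms by (auto simp: quat_arith algebra_simps)

subsection \<open>Hurwitz quaternions\<close>

text \<open>Coordinates with respect to the lattice basis (1+i+j+k)/2, i, j, k: four free integers
  replace the parity conditions.\<close>

lemma hurwitz_iff:
  "q \<in> hurwitz \<longleftrightarrow> (\<exists>p b c d :: int. q = Quat (of_int p / 2) (of_int p / 2 + of_int b)
     (of_int p / 2 + of_int c) (of_int p / 2 + of_int d))" (is "?L \<longleftrightarrow> ?R")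
proof
  assume ?L
  then obtain a b c d :: int where q: "q = Quat (of_int a / 2) (of_int b / 2) (of_int c / 2) (of_int d / 2)"
    and par: "even (b - a)" "even (c - a)" "even (d - a)"
    unfolding hurwitz_def by auto
  from par obtain b' c' d' where "b - a = 2 * b'" "c - a = 2 * c'" "d - a = 2 * d'"
    by (meson dvdE)
  then have "b = a + 2 * b'" "c = a + 2 * c'" "d = a + 2 * d'"
    by auto
  then have "q = Quat (of_int a / 2) (of_int a / 2 + of_int b') (of_int a / 2 + of_int c')
      (of_int a / 2 + of_int d')"
    unfolding q by (simp add: add_divide_distrib)
  then show ?R
    by blast
next
  assume ?R
  then obtain p b c d :: int where q: "q = Quat (of_int p / 2) (of_int p / 2 + of_int b)
     (of_int p / 2 + of_int c) (of_int p / 2 + of_int d)"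
    by blast
  have "q = Quat (of_int p / 2) (of_int (p + 2 * b) / 2) (of_int (p + 2 * c) / 2) (of_int (p + 2 * d) / 2)"
    unfolding q by (simp add: add_divide_distrib)
  then show ?L
    unfolding hurwitz_def by fastforce
qed

lemma hurwitzI:
  fixes p b c d :: int
  assumes "q = Quat (of_int p / 2) (of_int p / 2 + of_int b) (of_int p / 2 + of_int c)
    (of_int p / 2 + of_int d)"
  shows "q \<in> hurwitz"
  unfolding hurwitz_iff using assms by (intro exI)

lemma hurwitz_mult:
  assumes "p \<in> hurwitz" "q \<in> hurwitz"
  shows "p * q \<in> hurwitz"
proof -
  obtain r b c d :: int where p: "p = Quat (of_int r / 2) (of_int r / 2 + of_int b)
     (of_int r / 2 + of_int c) (of_int r / 2 + of_int d)"
    using assms(1) hurwitz_iff by auto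
  obtain r' b' c' d' :: int where q: "q = Quat (of_int r' / 2) (of_int r' / 2 + of_int b')
     (of_int r' / 2 + of_int c') (of_int r' / 2 + of_int d')"
    using assms(2) hurwitz_iff by auto
  \<comment> \<open>\<open>P\<close> is twice the real part of the product; the other coordinates
    then have to differ from \<open>P / 2\<close> by integers.\<close>
  define P where "P = - r * r' - r * (b' + c' + d') - r' * (b + c + d) - 2 * (b * b' + c * c' + d * d')"
  define s s' :: real where "s = of_int r / 2" and "s' = of_int r' / 2"
  have r: "real_of_int r = 2 * s" "real_of_int r' = 2 * s'"
    by (simp_all add: s_def s'_def)
  have "real_of_int P = 2 * (- 2 * s * s' - s * (b' + c' + d') - s' * (b + c + d) - (b * b' + c * c' + d * d'))"
    by (simp add: P_def r algebra_simps)
  from arg_cong[OF this, of "\<lambda>x. x / 2"] have P: "real_of_int P / 2 = - 2 * s * s' - s * (b' + c' + d') - s' * (b + c + d) - (b * b' + c * c' + d * d')"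
    by simp
  have "p * q = Quat (of_int P / 2)
     (of_int P / 2 + of_int (r * r' + r * (b' + d') + r' * (b + c) + b * b' + c * c' + d * d' + c * d' - d * c'))
     (of_int P / 2 + of_int (r * r' + r * (c' + b') + r' * (c + d) + b * b' + c * c' + d * d' + d * b' - b * d'))
     (of_int P / 2 + of_int (r * r' + r * (d' + c') + r' * (d + b) + b * b' + c * c' + d * d' + b * c' - c * b'))"
    unfolding p q P by (simp add: r times_quat_def algebra_simps)
  then show ?thesis
    by (rule hurwitzI)
qed

lemma hurwitz_add:
  assumes "p \<in> hurwitz" "q \<in> hurwitz"
  shows "p + q \<in> hurwitz"
proof -
  obtain r b c d :: int where p: "p = Quat (of_int r / 2) (of_int r / 2 + of_int b)
     (of_int r / 2 + of_int c) (of_int r / 2 + of_int d)"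
    using assms(1) hurwitz_iff by auto
  obtain r' b' c' d' :: int where q: "q = Quat (of_int r' / 2) (of_int r' / 2 + of_int b')
     (of_int r' / 2 + of_int c') (of_int r' / 2 + of_int d')"
    using assms(2) hurwitz_iff by auto
  have "p + q = Quat (of_int (r + r') / 2) (of_int (r + r') / 2 + of_int (b + b'))
     (of_int (r + r') / 2 + of_int (c + c')) (of_int (r + r') / 2 + of_int (d + d'))"
    unfolding p q by (simp add: plus_quat_def add_divide_distrib)
  then show ?thesis
    by (rule hurwitzI)
qed

lemma hurwitz_cnj:
  assumes "q \<in> hurwitz"
  shows "quat_cnj q \<in> hurwitz"
proof -
  obtain r b c d :: int where q: "q = Quat (of_int r / 2) (of_int r / 2 + of_int b)
     (of_int r / 2 + of_int c) (of_int r / 2 + of_int d)"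
    using assms hurwitz_iff by auto
  have "quat_cnj q = Quat (of_int r / 2) (of_int r / 2 + of_int (- r - b))
     (of_int r / 2 + of_int (- r - c)) (of_int r / 2 + of_int (- r - d))"
    unfolding q by (simp add: quat_cnj_def)
  then show ?thesis
    by (rule hurwitzI)
qed

lemma hurwitz_int: "Quat (of_int a) (of_int b) (of_int c) (of_int d) \<in> hurwitz"
  unfolding hurwitz_iff
  by (rule exI[of _ "2 * a"], rule exI[of _ "b - a"], rule exI[of _ "c - a"], rule exI[of _ "d - a"]) simp

lemma hurwitz_of_int: "of_int a \<in> hurwitz"
  using hurwitz_int[of a 0 0 0] by (simp add: of_int_quat)

lemma hurwitz_0: "0 \<in> hurwitz" and hurwitz_1: "1 \<in> hurwitz"
  using hurwitz_of_int[of 0] hurwitz_of_int[of 1] by simp_all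

lemma hurwitz_diff: "p \<in> hurwitz \<Longrightarrow> q \<in> hurwitz \<Longrightarrow> p - q \<in> hurwitz"
  using hurwitz_add[of p "of_int (- 1) * q"] hurwitz_mult[OF hurwitz_of_int, of q "- 1"] by simp

lemma hurwitz_norm_nat:
  assumes "q \<in> hurwitz"
  obtains n :: nat where "quat_norm q = of_nat n"
proof -
  obtain r b c d :: int where q: "q = Quat (of_int r / 2) (of_int r / 2 + of_int b)
     (of_int r / 2 + of_int c) (of_int r / 2 + of_int d)"
    using assms hurwitz_iff by auto
  have "quat_norm q = of_int (r * r + r * (b + c + d) + b * b + c * c + d * d)"
    unfolding q quat_norm_def by (simp add: power2_eq_square field_simps)
  then show ?thesis
    using that by (metis of_int_0_le_iff of_int_of_nat_eq quat_norm_nonneg zero_le_imp_eq_int)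
qed

text \<open>Rounding the coordinates leaves an error of norm at most 4 * (1/4) = 1. Equality occurs
  only if all four coordinates are halves of odd integers, and then \<open>q\<close> is itself
  Hurwitz. The strict bound is what Euclidean division needs.\<close>

lemma hurwitz_approx:
  obtains h where "h \<in> hurwitz" "quat_norm (q - h) < 1"
proof -
  have round: "\<exists>n :: int. \<bar>x - of_int n\<bar> \<le> 1 / 2" for x :: real
    using of_int_round_abs_le[of x] by (metis abs_minus_commute)
  obtain a b c d :: int where
    le: "\<bar>qRe q - of_int a\<bar> \<le> 1 / 2" "\<bar>qI q - of_int b\<bar> \<le> 1 / 2"
      "\<bar>qJ q - of_int c\<bar> \<le> 1 / 2" "\<bar>qK q - of_int d\<bar> \<le> 1 / 2"
    using round by metis
  define h where "h = Quat (of_int a) (of_int b) (of_int c) (of_int d)"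
  have sq: "(qRe q - of_int a)\<^sup>2 \<le> 1 / 4" "(qI q - of_int b)\<^sup>2 \<le> 1 / 4"
      "(qJ q - of_int c)\<^sup>2 \<le> 1 / 4" "(qK q - of_int d)\<^sup>2 \<le> 1 / 4"
    using le[THEN power_mono[where n = 2]] by (simp_all add: power_divide)
  have nh: "quat_norm (q - h) = (qRe q - of_int a)\<^sup>2 + (qI q - of_int b)\<^sup>2
      + (qJ q - of_int c)\<^sup>2 + (qK q - of_int d)\<^sup>2"
    by (simp add: quat_norm_def minus_quat_def h_def)
  show ?thesis
  proof (cases "quat_norm (q - h) < 1")
    case True
    then show ?thesis
      using that hurwitz_int h_def by blast
  next
    case False
    then have "(qRe q - of_int a)\<^sup>2 = (1 / 2)\<^sup>2" "(qI q - of_int b)\<^sup>2 = (1 / 2)\<^sup>2"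
      "(qJ q - of_int c)\<^sup>2 = (1 / 2)\<^sup>2" "(qK q - of_int d)\<^sup>2 = (1 / 2)\<^sup>2"
      using sq unfolding nh by (simp_all add: power_divide)
    then have cases: "qRe q - of_int a = 1 / 2 \<or> qRe q - of_int a = - (1 / 2)"
      "qI q - of_int b = 1 / 2 \<or> qI q - of_int b = - (1 / 2)"
      "qJ q - of_int c = 1 / 2 \<or> qJ q - of_int c = - (1 / 2)"
      "qK q - of_int d = 1 / 2 \<or> qK q - of_int d = - (1 / 2)"
      unfolding power2_eq_iff by blast+
    have half: "\<exists>n :: int. odd n \<and> x = of_int n / 2"
      if "x - of_int a = 1 / 2 \<or> x - of_int a = - (1 / 2)" for x :: real and a :: int
      using that
    proof
      assume "x - of_int a = 1 / 2"
      then have "odd (2 * a + 1)" "x = of_int (2 * a + 1) / 2" by auto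
      then show ?thesis by blast
    next
      assume "x - of_int a = - (1 / 2)"
      then have "odd (2 * a - 1)" "x = of_int (2 * a - 1) / 2" by auto
      then show ?thesis by blast
    qed
    obtain a' b' c' d' :: int where
      "odd a'" "qRe q = of_int a' / 2" "odd b'" "qI q = of_int b' / 2"
      "odd c'" "qJ q = of_int c' / 2" "odd d'" "qK q = of_int d' / 2"
      using half[OF cases(1)] half[OF cases(2)] half[OF cases(3)] half[OF cases(4)] by blast
    then have "q \<in> hurwitz"
      unfolding hurwitz_def by (cases q) auto
    then show ?thesis
      using that[of q] by (simp add: quat_norm_def zero_quat_def)
  qed
qed

text \<open>By Euclidean division, an element \<open>g\<close> of least norm generates the left
  ideal \<open>L\<close>. It is a common right divisor, so its norm is at most that of
  \<open>d\<close>; as \<open>d\<close> in turn right-divides \<open>g\<close>, the two differ by a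
  unit.\<close>

lemma hurwitz_bezout:
  assumes "p \<in> hurwitz" "q \<in> hurwitz" "p \<noteq> 0" "is_right_gcd d p q"
  obtains u v where "u \<in> hurwitz" "v \<in> hurwitz" "d = u * p + v * q"
proof -
  define L where "L = {u * p + v * q | u v. u \<in> hurwitz \<and> v \<in> hurwitz}"
  have LI: "u * p + v * q \<in> L" if "u \<in> hurwitz" "v \<in> hurwitz" for u v
    using that unfolding L_def by blast
  have pL: "p \<in> L" and qL: "q \<in> L"
    using LI[OF hurwitz_1 hurwitz_0] LI[OF hurwitz_0 hurwitz_1] by simp_all
  have LH: "L \<subseteq> hurwitz"
    using assms(1,2) by (auto simp: L_def intro: hurwitz_add hurwitz_mult)
  have Ldiff: "x - h * y \<in> L" if "x \<in> L" "y \<in> L" "h \<in> hurwitz" for x y h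
  proof -
    obtain u v u' v' where H: "u \<in> hurwitz" "v \<in> hurwitz" "u' \<in> hurwitz" "v' \<in> hurwitz"
      and eq: "x = u * p + v * q" "y = u' * p + v' * q"
      using \<open>x \<in> L\<close> \<open>y \<in> L\<close> unfolding L_def by blast
    have "x - h * y = (u - h * u') * p + (v - h * v') * q"
      unfolding eq by (simp add: algebra_simps)
    then show ?thesis
      using LI[of "u - h * u'" "v - h * v'"] H that(3) by (simp add: hurwitz_diff hurwitz_mult)
  qed
  define f where "f x = nat \<lfloor>quat_norm x\<rfloor>" for x
  have f: "quat_norm x = of_nat (f x)" if "x \<in> L" for x
    using that LH hurwitz_norm_nat[of x] by (metis f_def floor_of_nat nat_int subsetD)
  obtain g where g: "g \<in> L" "g \<noteq> 0" and min: "\<And>y. y \<in> L \<Longrightarrow> y \<noteq> 0 \<Longrightarrow> f g \<le> f y"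
    using ex_has_least_nat[of "\<lambda>x. x \<in> L \<and> x \<noteq> 0" p f] pL assms(3) by blast
  have gH: "g \<in> hurwitz"
    using g LH by blast
  have div: "\<exists>h\<in>hurwitz. x = h * g" if x: "x \<in> L" for x
  proof -
    obtain h where h: "h \<in> hurwitz" "quat_norm (x * inverse g - h) < 1"
      using hurwitz_approx .
    have "x - h * g = (x * inverse g - h) * g"
      using g(2) by (simp add: algebra_simps)
    then have "quat_norm (x - h * g) < quat_norm g"
      using h(2) g(2) quat_norm_nonneg[of g] quat_norm_eq_0_iff[of g]
      by (simp add: quat_norm_mult)
    moreover have "x - h * g \<in> L"
      using Ldiff x g(1) h(1) by blast
    ultimately have "x - h * g = 0"
      using min[of "x - h * g"] f g(1) by fastforce
    then show ?thesis
      using h(1) by auto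
  qed
  have "right_divisor g p" "right_divisor g q"
    using div pL qL gH by (auto simp: right_divisor_def)
  then have le: "quat_norm g \<le> quat_norm d" and dp: "right_divisor d p" and dq: "right_divisor d q"
    using assms(4) unfolding is_right_gcd_def by blast+
  from dp dq obtain h1 h2 where "h1 \<in> hurwitz" "h2 \<in> hurwitz" "p = h1 * d" "q = h2 * d"
    unfolding right_divisor_def by blast
  moreover from g(1) obtain u v where uv: "u \<in> hurwitz" "v \<in> hurwitz" "g = u * p + v * q"
    unfolding L_def by blast
  ultimately have k: "u * h1 + v * h2 \<in> hurwitz" "g = (u * h1 + v * h2) * d"
    by (simp_all add: hurwitz_add hurwitz_mult distrib_right mult.assoc)
  define k where "k = u * h1 + v * h2"
  have kH: "k \<in> hurwitz" and gk: "g = k * d"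
    using k by (simp_all add: k_def)
  have d0: "quat_norm d > 0"
    using g(2) gk quat_norm_nonneg[of d] quat_norm_eq_0_iff[of d] by fastforce
  obtain n where n: "quat_norm k = of_nat n"
    using hurwitz_norm_nat[OF kH] .
  have "n \<noteq> 0"
    using n g(2) gk quat_norm_eq_0_iff[of k] by auto
  moreover have "of_nat n * quat_norm d \<le> 1 * quat_norm d"
    using le gk n by (simp add: quat_norm_mult)
  ultimately have "quat_norm k = 1"
    using d0 n by (simp del: mult_1)
  then have "quat_cnj k * k = 1"
    by (simp add: quat_cnj_mult_self one_quat_def)
  then have "d = quat_cnj k * g"
    by (simp add: gk mult.assoc[symmetric])
  then have "d = (quat_cnj k * u) * p + (quat_cnj k * v) * q"
    unfolding uv(3) by (simp add: distrib_left mult.assoc)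
  then show ?thesis
    using that uv(1,2) kH hurwitz_cnj hurwitz_mult by blast
qed

subsection \<open>Face diagonals\<close>

text \<open>One representative of each pair of opposite pure Hurwitz quaternions of norm 2.\<close>

definition face_diagonals :: "quat set" where
  "face_diagonals = {Quat 0 1 1 0, Quat 0 1 (- 1) 0, Quat 0 1 0 1, Quat 0 1 0 (- 1),
     Quat 0 0 1 1, Quat 0 0 1 (- 1)}"

lemma face_diagonal_hurwitz: "\<tau> \<in> face_diagonals \<Longrightarrow> \<tau> \<in> hurwitz"
  using hurwitz_int[of 0 1 1 0] hurwitz_int[of 0 1 "-1" 0] hurwitz_int[of 0 1 0 1]
    hurwitz_int[of 0 1 0 "-1"] hurwitz_int[of 0 0 1 1] hurwitz_int[of 0 0 1 "-1"]
  by (auto simp: face_diagonals_def)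

lemma face_diagonal_square: "\<tau> \<in> face_diagonals \<Longrightarrow> \<tau> * \<tau> = - 2"
  by (auto simp: face_diagonals_def quat_arith numeral_quat)

lemma face_diagonal_norm: "\<tau> \<in> face_diagonals \<Longrightarrow> quat_norm \<tau> = 2"
  by (auto simp: face_diagonals_def quat_norm_def)

text \<open>Conjugation by \<open>\<tau>\<close> is a half-turn that permutes the imaginary
  coordinates up to sign, so it preserves all parity conditions. As the square of
  \<open>\<tau>\<close> is central, conjugation by \<open>\<tau>\<close> and by its inverse agree,
  and one \<open>h'\<close> serves both sides.\<close>

lemma face_diagonal_swap:
  assumes "\<tau> \<in> face_diagonals" "h \<in> hurwitz"
  obtains h' where "h' \<in> hurwitz" "\<tau> * h = h' * \<tau>" "h * \<tau> = \<tau> * h'"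
proof -
  obtain a b c d :: int where h: "h = Quat (of_int a / 2) (of_int b / 2) (of_int c / 2) (of_int d / 2)"
    and par: "even a \<longleftrightarrow> even b" "even a \<longleftrightarrow> even c" "even a \<longleftrightarrow> even d"
    using assms(2) unfolding hurwitz_def by auto
  have H: "Quat (of_int a / 2) (of_int b' / 2) (of_int c' / 2) (of_int d' / 2) \<in> hurwitz"
    if "even a \<longleftrightarrow> even b'" "even a \<longleftrightarrow> even c'" "even a \<longleftrightarrow> even d'" for b' c' d' :: int
    using that unfolding hurwitz_def by blast
  consider "\<tau> = Quat 0 1 1 0" | "\<tau> = Quat 0 1 (- 1) 0" | "\<tau> = Quat 0 1 0 1"
    | "\<tau> = Quat 0 1 0 (- 1)" | "\<tau> = Quat 0 0 1 1" | "\<tau> = Quat 0 0 1 (- 1)"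
    using assms(1) by (auto simp: face_diagonals_def)
  then show ?thesis
  proof cases
    case 1 show ?thesis
      by (rule that[OF H[of c b "- d"]]) (use par in \<open>auto simp: h 1 times_quat_def\<close>)
  next
    case 2 show ?thesis
      by (rule that[OF H[of "- c" "- b" "- d"]]) (use par in \<open>auto simp: h 2 times_quat_def\<close>)
  next
    case 3 show ?thesis
      by (rule that[OF H[of d "- c" b]]) (use par in \<open>auto simp: h 3 times_quat_def\<close>)
  next
    case 4 show ?thesis
      by (rule that[OF H[of "- d" "- c" "- b"]]) (use par in \<open>auto simp: h 4 times_quat_def\<close>)
  next
    case 5 show ?thesis
      by (rule that[OF H[of "- b" d c]]) (use par in \<open>auto simp: h 5 times_quat_def\<close>)
  next
    case 6 show ?thesis
      by (rule that[OF H[of "- b" "- d" "- c"]]) (use par in \<open>auto simp: h 6 times_quat_def\<close>)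
  qed
qed

lemma face_diagonals_associated:
  assumes "\<pi> \<in> face_diagonals" "\<tau> \<in> face_diagonals"
  obtains \<epsilon> where "\<epsilon> \<in> hurwitz" "\<pi> = \<epsilon> * \<tau>"
proof -
  \<comment> \<open>This is \<open>\<pi>\<close> times the inverse of \<open>\<tau>\<close>, because
    \<open>\<tau> * \<tau> = - 2\<close>. Its coordinates turn out to be all integers or all 1/2 up
    to sign.\<close>
  define \<epsilon> where "\<epsilon> = Quat (- (1 / 2)) 0 0 0 * (\<pi> * \<tau>)"
  have half: "Quat a b c d \<in> hurwitz"
    if "\<bar>a\<bar> = 1 / 2" "\<bar>b\<bar> = 1 / 2" "\<bar>c\<bar> = 1 / 2" "\<bar>d\<bar> = 1 / 2" for a b c d
  proof -
    have "\<exists>n :: int. odd n \<and> x = of_int n / 2" if "\<bar>x\<bar> = 1 / 2" for x :: real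
    proof (cases "x \<ge> 0")
      case True
      then show ?thesis
        using that by (intro exI[of _ 1]) simp
    next
      case False
      then show ?thesis
        using that by (intro exI[of _ "- 1"]) simp
    qed
    from this[OF that(1)] this[OF that(2)] this[OF that(3)] this[OF that(4)] show ?thesis
      unfolding hurwitz_def by blast
  qed
  have int: "Quat a b c d \<in> hurwitz" if "a \<in> \<int>" "b \<in> \<int>" "c \<in> \<int>" "d \<in> \<int>" for a b c d
    using that hurwitz_int by (auto elim!: Ints_cases)
  have "\<epsilon> \<in> hurwitz"
    using assms unfolding face_diagonals_def \<epsilon>_def
    by (elim insertE emptyE; simp add: times_quat_def half int)
  moreover have "\<pi> = \<epsilon> * \<tau>"
    by (simp add: \<epsilon>_def mult.assoc face_diagonal_square[OF assms(2)])
      (simp add: quat_arith numeral_quat)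
  ultimately show ?thesis
    using that by blast
qed

lemma exists_orthogonal_face_diagonal_iff:
  "(\<exists>\<tau>\<in>face_diagonals. qI \<tau> * x + qJ \<tau> * y + qK \<tau> * z = 0) \<longleftrightarrow>
    \<bar>x\<bar> = \<bar>y\<bar> \<or> \<bar>x\<bar> = \<bar>z\<bar> \<or> \<bar>y\<bar> = \<bar>z\<bar>"
  by (auto simp: face_diagonals_def abs_eq_iff)

lemma int_sum_three_squares_eq_2:
  fixes b c d :: int
  assumes "b\<^sup>2 + c\<^sup>2 + d\<^sup>2 = 2"
  shows "b = 0 \<and> \<bar>c\<bar> = 1 \<and> \<bar>d\<bar> = 1 \<or> \<bar>b\<bar> = 1 \<and> c = 0 \<and> \<bar>d\<bar> = 1 \<or> \<bar>b\<bar> = 1 \<and> \<bar>c\<bar> = 1 \<and> d = 0"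
proof -
  have bound: "\<bar>x\<bar> \<le> 1" if "x\<^sup>2 \<le> 2" for x :: int
  proof (rule ccontr)
    assume "\<not> \<bar>x\<bar> \<le> 1"
    then have "2\<^sup>2 \<le> \<bar>x\<bar>\<^sup>2" by (intro power_mono) auto
    then show False using that by simp
  qed
  have "\<bar>b\<bar> \<le> 1" "\<bar>c\<bar> \<le> 1" "\<bar>d\<bar> \<le> 1"
    using assms bound[of b] bound[of c] bound[of d]
      zero_le_power2[of b] zero_le_power2[of c] zero_le_power2[of d] by linarith+
  then have "b \<in> {-1, 0, 1}" "c \<in> {-1, 0, 1}" "d \<in> {-1, 0, 1}"
    by auto
  then show ?thesis
    using assms by auto
qed

lemma pure_hurwitz_int:
  assumes "q \<in> hurwitz" "qRe q = 0"
  obtains a b c :: int where "q = Quat 0 (of_int a) (of_int b) (of_int c)"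
proof -
  obtain r b c d :: int where q: "q = Quat (of_int r / 2) (of_int r / 2 + of_int b)
     (of_int r / 2 + of_int c) (of_int r / 2 + of_int d)"
    using assms(1) hurwitz_iff by auto
  then show ?thesis
    using assms(2) that by auto
qed

text \<open>A pure Hurwitz quaternion of norm 2 has integer coordinates, two of them 1 or -1 and the
  third 0; orthogonality to it equates two of the given coordinates up to sign.\<close>

lemma orthogonal_norm_2_abs_eq:
  assumes "q \<in> hurwitz" "qRe q = 0" "quat_norm q = 2" "qI q * x + qJ q * y + qK q * z = 0"
  shows "\<bar>x\<bar> = \<bar>y\<bar> \<or> \<bar>x\<bar> = \<bar>z\<bar> \<or> \<bar>y\<bar> = \<bar>z\<bar>"
proof -
  obtain a b c :: int where q: "q = Quat 0 (of_int a) (of_int b) (of_int c)"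
    using pure_hurwitz_int[OF assms(1,2)] .
  have "real_of_int (a\<^sup>2 + b\<^sup>2 + c\<^sup>2) = of_int 2"
    using assms(3) by (simp add: q quat_norm_def)
  then have "a\<^sup>2 + b\<^sup>2 + c\<^sup>2 = 2"
    unfolding of_int_eq_iff .
  from int_sum_three_squares_eq_2[OF this] show ?thesis
    using assms(4) by (auto simp: q abs_eq_iff abs_if split: if_splits)
qed

subsection \<open>The quadratic order\<close>

text \<open>The cofactor \<open>k\<close> of gcd(m, x) in \<open>m\<close> is coprime to that of
  \<open>x\<close>, hence divides the gcd. Its square then divides \<open>m\<close>, so
  \<open>k\<close> is 1.\<close>

lemma squarefree_dvd_square:
  fixes m x :: nat
  assumes "squarefree m" "m dvd x\<^sup>2"
  shows "m dvd x"
proof -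
  have m0: "m \<noteq> 0"
    using assms(1) by (metis not_squarefree_0)
  obtain k l where kl: "m = k * gcd m x" "x = l * gcd m x" "coprime k l"
    using gcd_coprime_exists[of m x] m0 by auto
  have "k * gcd m x dvd (l\<^sup>2 * gcd m x) * gcd m x"
    using assms(2) by (metis kl(1,2) power2_eq_square mult.assoc mult.commute)
  then have "k dvd l\<^sup>2 * gcd m x"
    using m0 by simp
  then have "k dvd gcd m x"
    using kl(3) by (simp add: coprime_dvd_mult_right_iff)
  then have "k\<^sup>2 dvd m"
    by (subst kl(1)) (simp add: power2_eq_square)
  then have "k = 1"
    using assms(1) squarefreeD by fastforce
  then show ?thesis
    using kl(1) by (metis gcd_dvd2 mult_1)
qed

text \<open>The two integrality assumptions give u^2 = v m, so \<open>m\<close> divides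
  \<open>u\<close>, and t = u / m is an integer.\<close>

lemma squarefree_multiplier_int:
  fixes t :: real and m :: nat
  assumes "squarefree m" "t * of_nat m = of_int u" "t\<^sup>2 * of_nat m = of_int v"
  obtains s :: int where "t = of_int s"
proof -
  have m0: "m \<noteq> 0"
    using assms(1) by (metis not_squarefree_0)
  have "real_of_int (u\<^sup>2) = (t\<^sup>2 * of_nat m) * of_nat m"
    using assms(2) by (simp flip: assms(2)) (simp add: power2_eq_square)
  also have "\<dots> = real_of_int (v * int m)"
    by (simp add: assms(3))
  finally have "u\<^sup>2 = v * int m"
    unfolding of_int_eq_iff .
  then have "int m dvd u\<^sup>2"
    by simp
  then have "m dvd (nat \<bar>u\<bar>)\<^sup>2"
    by (metis int_dvd_int_iff of_nat_power nat_0_le abs_ge_zero power2_abs int_nat_eq)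
  then have "m dvd nat \<bar>u\<bar>"
    using squarefree_dvd_square[OF assms(1)] by blast
  then have "int m dvd u"
    by (metis int_dvd_int_iff dvd_abs_iff int_nat_eq abs_ge_zero)
  then obtain s where "u = int m * s" ..
  then have "t = of_int s"
    using assms(2) m0 by simp
  then show ?thesis
    using that by blast
qed

lemma odd_square_mod_4:
  fixes x :: int
  shows "x\<^sup>2 mod 4 = (if odd x then 1 else 0)"
proof (cases "even x")
  case True
  then obtain k where "x = 2 * k" ..
  then show ?thesis
    by (simp add: power2_eq_square)
next
  case False
  then obtain k where "x = 2 * k + 1"
    using oddE by blast
  then have "x\<^sup>2 = 1 + (k\<^sup>2 + k) * 4"
    by (simp add: power2_eq_square algebra_simps)
  then have "x\<^sup>2 mod 4 = 1"
    by (simp only: mod_mult_self1) simp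
  then show ?thesis
    using False by simp
qed

lemma sum_squares_mod_4_eq_3_iff:
  fixes x y z :: int
  shows "(x\<^sup>2 + y\<^sup>2 + z\<^sup>2) mod 4 = 3 \<longleftrightarrow> odd x \<and> odd y \<and> odd z"
proof -
  have "(x\<^sup>2 + y\<^sup>2 + z\<^sup>2) mod 4 = ((x\<^sup>2 mod 4 + y\<^sup>2 mod 4) mod 4 + z\<^sup>2 mod 4) mod 4"
    by (simp only: mod_add_eq)
  then show ?thesis
    by (simp only: odd_square_mod_4) simp
qed

section \<open>The order as the commutant of \<open>\<mu>\<close> in the Hurwitz quaternions\<close>

locale squarefree_pure =
  fixes \<mu> :: quat and x y z :: int and m :: nat
  assumes mu: "\<mu> = Quat 0 (of_int x) (of_int y) (of_int z)"
    and sum_squares: "x\<^sup>2 + y\<^sup>2 + z\<^sup>2 = int m"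
    and sqf: "squarefree m"
begin

lemma m_nonzero: "m \<noteq> 0"
  using sqf by (metis not_squarefree_0)

lemma norm_mu: "quat_norm \<mu> = of_nat m"
proof -
  have "quat_norm \<mu> = of_int (x\<^sup>2 + y\<^sup>2 + z\<^sup>2)"
    by (simp add: mu quat_norm_def)
  then show ?thesis
    unfolding sum_squares by simp
qed

lemma mu_nonzero: "\<mu> \<noteq> 0"
  using norm_mu m_nonzero quat_norm_eq_0_iff[of \<mu>] by simp

text \<open>Translates the case distinction in \<open>denom\<close> into parity: the half-integral
  \<open>omega \<mu>\<close> occurs exactly when it is a Hurwitz quaternion.\<close>

lemma mod_4_eq_3_iff: "m mod 4 = 3 \<longleftrightarrow> odd x \<and> odd y \<and> odd z"
proof -
  have "m mod 4 = 3 \<longleftrightarrow> int m mod 4 = 3"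
    by presburger
  then show ?thesis
    unfolding sum_squares[symmetric] by (simp only: sum_squares_mod_4_eq_3_iff)
qed

lemma denom_mu: "denom \<mu> = (if m mod 4 = 3 then 2 else 1)"
proof -
  have "m mod 4 = 3 \<longleftrightarrow> int m mod 4 = 3"
    by presburger
  then show ?thesis
    by (simp add: denom_def norm_mu)
qed

lemma omega_mu_mod_4_eq_3:
  assumes "m mod 4 = 3"
  shows "omega \<mu> = Quat (1 / 2) (of_int x / 2) (of_int y / 2) (of_int z / 2)"
proof -
  have "inverse (2 :: quat) = Quat (1 / 2) 0 0 0"
    by (simp add: inverse_quat_def numeral_quat quat_cnj_def quat_norm_def power2_eq_square)
  moreover have "omega \<mu> = (1 + \<mu>) * inverse 2"
    unfolding omega_def denom_mu divide_quat_def using assms by simp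
  ultimately have "omega \<mu> = (1 + \<mu>) * Quat (1 / 2) 0 0 0"
    by (simp only:)
  then show ?thesis
    by (simp add: mu quat_arith)
qed

lemma omega_mu_mod_4_neq_3: "m mod 4 \<noteq> 3 \<Longrightarrow> omega \<mu> = \<mu>"
  by (simp add: omega_def denom_mu)

lemma int_comb_mu_quad_order: "of_int a + of_int b * \<mu> \<in> quad_order \<mu>"
proof (cases "m mod 4 = 3")
  case True
  \<comment> \<open>In this case \<open>\<mu>\<close> equals 2 \<open>omega \<mu>\<close> -
    1.\<close>
  have "of_int a + of_int b * \<mu> = of_int (a - b) + of_int (2 * b) * omega \<mu>"
    unfolding of_int_quat omega_mu_mod_4_eq_3[OF True] by (simp add: mu quat_arith)
  then show ?thesis
    unfolding quad_order_def by blast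
next
  case False
  then show ?thesis
    unfolding quad_order_def by (auto simp: omega_mu_mod_4_neq_3)
qed

lemma omega_hurwitz: "omega \<mu> \<in> hurwitz"
proof (cases "m mod 4 = 3")
  case True
  then have "odd x \<and> odd y \<and> odd z"
    using mod_4_eq_3_iff by blast
  moreover have "omega \<mu> = Quat (of_int 1 / 2) (of_int x / 2) (of_int y / 2) (of_int z / 2)"
    by (simp add: omega_mu_mod_4_eq_3[OF True])
  ultimately show ?thesis
    unfolding hurwitz_def by fastforce
next
  case False
  then show ?thesis
    unfolding omega_mu_mod_4_neq_3[OF False] using hurwitz_int[of 0 x y z] by (simp add: mu)
qed

lemma omega_commute: "omega \<mu> * \<mu> = \<mu> * omega \<mu>"
  by (cases "m mod 4 = 3")
    (simp_all add: omega_mu_mod_4_neq_3 omega_mu_mod_4_eq_3, simp add: mu times_quat_def)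

text \<open>This is where maximality of the order enters. An element of the commutant has vector
  part \<open>t\<close> times \<open>\<mu>\<close>, and squarefreeness of \<open>m\<close> makes
  \<open>2 * t\<close> an integer. With integer coordinates, \<open>t\<close> itself is an integer;
  otherwise \<open>x\<close>, \<open>y\<close>, \<open>z\<close> are odd and
  \<open>omega \<mu>\<close> is available.\<close>

lemma quad_order_eq: "quad_order \<mu> = {q \<in> hurwitz. q * \<mu> = \<mu> * q}"
proof (intro equalityI subsetI)
  fix q
  assume "q \<in> quad_order \<mu>"
  then obtain a b :: int where q: "q = of_int a + of_int b * omega \<mu>"
    unfolding quad_order_def by blast
  have central: "of_int n * p = p * of_int n" for n and p :: quat
    by (simp add: of_int_quat times_quat_def)
  have "q * \<mu> = \<mu> * q"
    unfolding q by (simp only: distrib_left distrib_right central[of a \<mu>]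
      commute_mult[OF central omega_commute])
  then show "q \<in> {q \<in> hurwitz. q * \<mu> = \<mu> * q}"
    by (simp add: q hurwitz_add hurwitz_mult hurwitz_of_int omega_hurwitz)
next
  fix q
  assume "q \<in> {q \<in> hurwitz. q * \<mu> = \<mu> * q}"
  then have qH: "q \<in> hurwitz" and comm: "q * \<mu> = \<mu> * q"
    by simp_all
  obtain t where t: "q = Quat (qRe q) (t * of_int x) (t * of_int y) (t * of_int z)"
    using commute_pure_quatE comm mu_nonzero unfolding mu by metis
  obtain A B C D :: int where q: "q = Quat (of_int A / 2) (of_int B / 2) (of_int C / 2) (of_int D / 2)"
    and par: "even A \<longleftrightarrow> even B" "even A \<longleftrightarrow> even C" "even A \<longleftrightarrow> even D"
    using qH unfolding hurwitz_def by auto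
  have tB: "2 * t * of_int x = of_int B" "2 * t * of_int y = of_int C" "2 * t * of_int z = of_int D"
    using t unfolding q by simp_all
  \<comment> \<open>If \<open>r\<close> times \<open>\<mu>\<close> has integer coordinates, its
    inner product with \<open>\<mu>\<close> and its norm are integers; these are the inputs of
    \<open>squarefree_multiplier_int\<close>.\<close>
  have rational: "r * of_nat m = of_int (b * x + c * y + d * z)"
    "r\<^sup>2 * of_nat m = of_int (b\<^sup>2 + c\<^sup>2 + d\<^sup>2)"
    if "r * of_int x = of_int b" "r * of_int y = of_int c" "r * of_int z = of_int d"
    for r :: real and b c d :: int
  proof -
    have m: "real m = (of_int x)\<^sup>2 + (of_int y)\<^sup>2 + (of_int z)\<^sup>2"
      using arg_cong[OF sum_squares, of real_of_int] by simp
    show "r * of_nat m = of_int (b * x + c * y + d * z)"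
      unfolding m by (simp flip: that add: power2_eq_square algebra_simps)
    show "r\<^sup>2 * of_nat m = of_int (b\<^sup>2 + c\<^sup>2 + d\<^sup>2)"
      unfolding m by (simp flip: that add: power2_eq_square algebra_simps)
  qed
  obtain s :: int where s: "2 * t = of_int s"
    using squarefree_multiplier_int[OF sqf rational[OF tB]] .
  show "q \<in> quad_order \<mu>"
  proof (cases "even A")
    case True
    then obtain A' B' C' D' where eq: "A = 2 * A'" "B = 2 * B'" "C = 2 * C'" "D = 2 * D'"
      using par by (metis dvdE)
    have "t * of_int x = of_int B'" "t * of_int y = of_int C'" "t * of_int z = of_int D'"
      using tB by (simp_all add: eq)
    from squarefree_multiplier_int[OF sqf rational[OF this]] obtain s' :: int
      where "t = of_int s'" .
    then have "q = of_int A' + of_int s' * \<mu>"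
      using t q by (simp add: of_int_quat mu quat_arith eq)
    then show ?thesis
      using int_comb_mu_quad_order by simp
  next
    case False
    have "real_of_int (s * x) = of_int B" "real_of_int (s * y) = of_int C" "real_of_int (s * z) = of_int D"
      using tB by (simp_all add: s)
    then have sB: "s * x = B" "s * y = C" "s * z = D"
      unfolding of_int_eq_iff .
    \<comment> \<open>The doubled coordinates \<open>B\<close>, \<open>C\<close>, \<open>D\<close>
      are odd here, and so are all their factors.\<close>
    then have odd: "odd s" "odd x" "odd y" "odd z"
      using False par by auto
    then have m3: "m mod 4 = 3"
      using mod_4_eq_3_iff by blast
    have "even (A - s)"
      using False odd(1) by simp
    then obtain n where n: "A - s = 2 * n" ..
    then have A: "A = s + 2 * n"
      by simp
    have "q = Quat (of_int (s + 2 * n) / 2) (of_int (s * x) / 2) (of_int (s * y) / 2) (of_int (s * z) / 2)"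
      unfolding q A sB ..
    then have "q = of_int n + of_int s * omega \<mu>"
      unfolding of_int_quat omega_mu_mod_4_eq_3[OF m3] by (simp add: quat_arith add_divide_distrib)
    then show ?thesis
      unfolding quad_order_def by blast
  qed
qed

section \<open>Commutativity, ideal equivalence and ambiguous classes\<close>

lemma commutant_commutative:
  assumes "p * \<mu> = \<mu> * p" "q * \<mu> = \<mu> * q"
  shows "p * q = q * p"
  using commutant_pure_commutative assms mu_nonzero unfolding mu by blast

lemma quad_order_commute: "p \<in> quad_order \<mu> \<Longrightarrow> q \<in> quad_order \<mu> \<Longrightarrow> p * q = q * p"
  by (simp add: quad_order_eq commutant_commutative)

lemma quad_order_mult_nonzero:
  "p \<in> quad_order \<mu> - {0} \<Longrightarrow> q \<in> quad_order \<mu> - {0} \<Longrightarrow> p * q \<in> quad_order \<mu> - {0}"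
  by (simp add: quad_order_eq hurwitz_mult commute_mult)

lemma mu_quad_order: "\<mu> \<in> quad_order \<mu>"
  using int_comb_mu_quad_order[of 0 1] by simp

lemma one_quad_order: "1 \<in> quad_order \<mu>"
  using int_comb_mu_quad_order[of 1 0] by simp

lemma ideal_equiv_refl: "ideal_equiv \<mu> I I"
  unfolding ideal_equiv_def using one_quad_order by (intro bexI[of _ 1]) simp_all

lemma ideal_equiv_sym: "ideal_equiv \<mu> I J \<Longrightarrow> ideal_equiv \<mu> J I"
  unfolding ideal_equiv_def by metis

lemma ideal_equiv_trans:
  assumes "ideal_equiv \<mu> I J" "ideal_equiv \<mu> J L"
  shows "ideal_equiv \<mu> I L"
proof -
  obtain \<alpha> \<beta> where ab: "\<alpha> \<in> quad_order \<mu> - {0}" "\<beta> \<in> quad_order \<mu> - {0}"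
    "(*) \<alpha> ` I = (*) \<beta> ` J"
    using assms(1) unfolding ideal_equiv_def by blast
  obtain \<gamma> \<delta> where cd: "\<gamma> \<in> quad_order \<mu> - {0}" "\<delta> \<in> quad_order \<mu> - {0}"
    "(*) \<gamma> ` J = (*) \<delta> ` L"
    using assms(2) unfolding ideal_equiv_def by blast
  have img: "(*) (p * q) ` S = (*) p ` (*) q ` S" for p q :: quat and S
    by (simp add: image_image mult.assoc)
  have "(*) (\<gamma> * \<alpha>) ` I = (*) (\<gamma> * \<beta>) ` J"
    by (simp add: img ab(3))
  also have "\<gamma> * \<beta> = \<beta> * \<gamma>"
    using quad_order_commute ab(2) cd(1) by simp
  also have "(*) (\<beta> * \<gamma>) ` J = (*) (\<beta> * \<delta>) ` L"
    by (simp add: img cd(3))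
  finally show ?thesis
    unfolding ideal_equiv_def using quad_order_mult_nonzero ab(1,2) cd(1,2) by blast
qed

text \<open>Comparing the two classes on the single member \<open>I\<close> gives the forward
  direction without showing that the conjugate of \<open>I\<close> is an ideal.\<close>

lemma ambiguous_class_iff:
  assumes "nonzero_ideal \<mu> I"
  shows "ambiguous_class \<mu> I \<longleftrightarrow> ideal_equiv \<mu> I (quat_cnj ` I)"
proof
  assume "ambiguous_class \<mu> I"
  moreover have "I \<in> ideal_class \<mu> I"
    using assms ideal_equiv_refl by (simp add: ideal_class_def)
  ultimately have "I \<in> ideal_class \<mu> (quat_cnj ` I)"
    by (simp add: ambiguous_class_def)
  then show "ideal_equiv \<mu> I (quat_cnj ` I)"
    using ideal_equiv_sym by (simp add: ideal_class_def)
next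
  assume "ideal_equiv \<mu> I (quat_cnj ` I)"
  then show "ambiguous_class \<mu> I"
    unfolding ambiguous_class_def ideal_class_def
    using ideal_equiv_sym ideal_equiv_trans by blast
qed

section \<open>Pseudo generators as generators of left ideals of Hurwitz quaternions\<close>

lemma R_ideal_iff:
  assumes "\<rho> \<in> hurwitz"
  shows "q \<in> R_ideal \<mu> \<rho> \<longleftrightarrow> q * \<mu> = \<mu> * q \<and> (\<exists>h\<in>hurwitz. q = h * \<rho>)"
  using assms unfolding R_ideal_def quad_order_eq by (auto intro: hurwitz_mult)

text \<open>Puts \<open>\<rho>\<close> into the left ideal H I generated by \<open>I\<close>, by
  applying Bezout to the gcd and moving the central factor \<open>c\<close> inside. For
  \<open>I = R_ideal \<mu> \<rho>\<close>, which lies in H \<open>\<rho>\<close>, this yields H I =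
  H \<open>\<rho>\<close>.\<close>

lemma right_pseudo_generator_bezout:
  assumes "right_pseudo_generator \<mu> I \<rho>"
  obtains u v a b where "u \<in> hurwitz" "v \<in> hurwitz" "a \<in> I" "b \<in> I" "\<rho> = u * a + v * b"
    "\<rho> \<in> hurwitz" "\<rho> \<noteq> 0"
proof -
  obtain a b c :: int and \<delta> where "a > 0" "c > 0"
    and I: "I = int_span2 (of_int c * of_int a) (of_int c * (of_int b + omega \<mu>))"
    and gcd: "is_right_gcd \<delta> (of_int a) (of_int b + omega \<mu>)"
    and \<rho>: "\<rho> = of_int c * \<delta>"
    using assms unfolding right_pseudo_generator_def by blast
  have nz: "(of_int n :: quat) \<noteq> 0" if "n > 0" for n
    using that by (simp add: of_int_quat zero_quat_def)
  have central: "of_int n * p = p * of_int n" for n and p :: quat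
    by (simp add: of_int_quat times_quat_def)
  obtain u v where uv: "u \<in> hurwitz" "v \<in> hurwitz" "\<delta> = u * of_int a + v * (of_int b + omega \<mu>)"
    using hurwitz_bezout[OF hurwitz_of_int hurwitz_add[OF hurwitz_of_int omega_hurwitz] nz gcd]
      \<open>a > 0\<close> by blast
  have "\<delta> \<in> hurwitz" "\<delta> \<noteq> 0"
    using gcd nz[OF \<open>a > 0\<close>] by (auto simp: is_right_gcd_def right_divisor_def)
  then have \<rho>0: "\<rho> \<in> hurwitz" "\<rho> \<noteq> 0"
    using nz[OF \<open>c > 0\<close>] by (simp_all add: \<rho> hurwitz_mult hurwitz_of_int)
  have "\<rho> = u * (of_int c * of_int a) + v * (of_int c * (of_int b + omega \<mu>))"
  proof -
    have "of_int c * (w * p) = w * (of_int c * p)" for w p :: quat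
      by (simp only: mult.assoc[symmetric] central[of c w])
    then show ?thesis
      unfolding \<rho> uv(3) by (simp only: distrib_left[of "of_int c" "_ * _"])
  qed
  moreover have "of_int c * of_int a \<in> I" "of_int c * (of_int b + omega \<mu>) \<in> I"
    unfolding I int_span2_def
    by (rule CollectI, rule exI[of _ 1], rule exI[of _ 0], simp)
      (rule CollectI, rule exI[of _ 0], rule exI[of _ 1], simp)
  ultimately show ?thesis
    using that uv(1,2) \<rho>0 by blast
qed

text \<open>Since \<open>I\<close> is closed under multiplication by \<open>\<mu>\<close>, the
  product \<open>\<rho> * \<mu>\<close> lies in H I, hence in H \<open>\<rho>\<close>.\<close>

lemma conjugate_hurwitz:
  assumes "nonzero_ideal \<mu> (R_ideal \<mu> \<rho>)" "right_pseudo_generator \<mu> (R_ideal \<mu> \<rho>) \<rho>"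
  shows "\<rho> * \<mu> * inverse \<rho> \<in> hurwitz"
proof -
  obtain u v a b where uv: "u \<in> hurwitz" "v \<in> hurwitz" "a \<in> R_ideal \<mu> \<rho>" "b \<in> R_ideal \<mu> \<rho>"
    "\<rho> = u * a + v * b" and \<rho>: "\<rho> \<in> hurwitz" "\<rho> \<noteq> 0"
    using right_pseudo_generator_bezout[OF assms(2)] .
  have closed: "w * \<mu> \<in> R_ideal \<mu> \<rho>" if "w \<in> R_ideal \<mu> \<rho>" for w
    using ideal.I_r_closed[of "R_ideal \<mu> \<rho>" "quad_order_ring \<mu>" w \<mu>] that assms(1) mu_quad_order
    by (simp add: nonzero_ideal_def quad_order_ring_def)
  obtain h k where hk: "h \<in> hurwitz" "a * \<mu> = h * \<rho>" "k \<in> hurwitz" "b * \<mu> = k * \<rho>"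
    using closed[OF uv(3)] closed[OF uv(4)] unfolding R_ideal_iff[OF \<rho>(1)] by blast
  have "\<rho> * \<mu> = (u * h + v * k) * \<rho>"
    by (subst uv(5)) (simp add: distrib_right mult.assoc hk)
  then have "\<rho> * \<mu> * inverse \<rho> = u * h + v * k"
    using \<rho>(2) by (simp add: mult.assoc)
  then show ?thesis
    using uv hk by (simp add: hurwitz_add hurwitz_mult)
qed

section \<open>Ambiguity of the class in terms of elements anticommuting with the conjugate of
  \<open>\<mu>\<close>\<close>

lemma anticommuting_cnj:
  assumes "\<tau> * \<mu> = - (\<mu> * \<tau>)" "p * \<mu> = \<mu> * p"
  shows "\<tau> * p = quat_cnj p * \<tau>"
  using anticommute_commutant assms mu_nonzero unfolding mu by blast

text \<open>If \<open>\<alpha> \<cdot> cnj I = \<beta> \<cdot> I\<close>, then \<open>\<rho> \<beta>\<close> and \<open>\<tau> \<rho> \<tau>\<^sup>-\<^sup>1 \<alpha>\<close> generate the same left ideal of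
  Hurwitz quaternions, hence differ by a unit \<open>\<epsilon>\<close>; the witness is \<open>\<epsilon> \<tau>\<close>.\<close>

lemma anticommuting_norm_2_if_equiv:
  assumes pg: "right_pseudo_generator \<mu> (R_ideal \<mu> \<rho>) \<rho>"
    and \<tau>: "\<tau> \<in> face_diagonals" "\<tau> * \<mu> = - (\<mu> * \<tau>)"
    and equiv: "ideal_equiv \<mu> (quat_cnj ` R_ideal \<mu> \<rho>) (R_ideal \<mu> \<rho>)"
    and k: "\<rho> * \<mu> = k * \<rho>"
  obtains q where "q \<in> hurwitz" "quat_norm q = 2" "q * k = - (k * q)"
proof -
  define I where "I = R_ideal \<mu> \<rho>"
  obtain u v a b where uv: "u \<in> hurwitz" "v \<in> hurwitz" "a \<in> I" "b \<in> I"
    "\<rho> = u * a + v * b" and \<rho>: "\<rho> \<in> hurwitz" "\<rho> \<noteq> 0"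
    using right_pseudo_generator_bezout[OF pg] unfolding I_def .
  obtain \<alpha> \<beta> where \<alpha>: "\<alpha> * \<mu> = \<mu> * \<alpha>" "\<alpha> \<noteq> 0" and \<beta>: "\<beta> * \<mu> = \<mu> * \<beta>" "\<beta> \<noteq> 0"
    and img: "(*) \<alpha> ` quat_cnj ` I = (*) \<beta> ` I"
    using equiv unfolding ideal_equiv_def I_def quad_order_eq by blast
  have II: "w \<in> I \<longleftrightarrow> w * \<mu> = \<mu> * w \<and> (\<exists>h\<in>hurwitz. w = h * \<rho>)" for w
    unfolding I_def using R_ideal_iff[OF \<rho>(1)] .
  have \<tau>0: "\<tau> \<noteq> 0"
    using face_diagonal_norm[OF \<tau>(1)] quat_norm_eq_0_iff[of \<tau>] by auto
  \<comment> \<open>\<open>\<sigma>\<close> generates the left ideal spanned by the conjugate of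
    \<open>I\<close>: conjugation by \<open>\<tau>\<close> carries H to itself, \<open>I\<close> to
    its conjugate and \<open>\<rho>\<close> to \<open>\<sigma>\<close>.\<close>
  define \<sigma> where "\<sigma> = \<tau> * \<rho> * inverse \<tau>"
  have conj: "\<tau> * w * inverse \<tau> = quat_cnj w" if "w \<in> I" for w
    using anticommuting_cnj[OF \<tau>(2), of w] that II \<tau>0 by (simp add: mult.assoc)
  have cnj_comm: "quat_cnj w * \<mu> = \<mu> * quat_cnj w" if "w \<in> I" for w
    using that II commute_cnj unfolding mu by blast
  have cnj_\<sigma>: "\<exists>h\<in>hurwitz. quat_cnj w = h * \<sigma>" if wI: "w \<in> I" for w
  proof -
    obtain h where h: "h \<in> hurwitz" "w = h * \<rho>"
      using wI II by blast
    obtain h' where h': "h' \<in> hurwitz" "\<tau> * h = h' * \<tau>" "h * \<tau> = \<tau> * h'"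
      using face_diagonal_swap[OF \<tau>(1) h(1)] .
    have "quat_cnj w = (\<tau> * h) * \<rho> * inverse \<tau>"
      using conj[OF wI] by (simp add: h(2) mult.assoc)
    also have "\<dots> = h' * \<sigma>"
      unfolding h'(2) by (simp add: \<sigma>_def mult.assoc)
    finally show ?thesis
      using h'(1) by blast
  qed
  \<comment> \<open>The multipliers move to the right inside the commutative commutant, so that they
    do not separate Hurwitz factors from the generators.\<close>
  have to_\<sigma>: "\<exists>h\<in>hurwitz. w * \<beta> = h * (\<sigma> * \<alpha>)" if "w \<in> I" for w
  proof -
    have "\<beta> * w \<in> (*) \<alpha> ` quat_cnj ` I"
      unfolding img using that by blast
    then obtain w' where w': "w' \<in> I" "\<beta> * w = \<alpha> * quat_cnj w'"
      by blast
    then have "w * \<beta> = quat_cnj w' * \<alpha>"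
      using commutant_commutative[of \<beta> w] commutant_commutative[of \<alpha> "quat_cnj w'"] that II \<alpha>(1) \<beta>(1)
        cnj_comm[OF w'(1)] by auto
    moreover obtain h where "h \<in> hurwitz" "quat_cnj w' = h * \<sigma>"
      using cnj_\<sigma>[OF w'(1)] by blast
    ultimately show ?thesis
      by (intro bexI[of _ h]) (simp_all add: mult.assoc)
  qed
  have to_\<rho>: "\<exists>h\<in>hurwitz. quat_cnj w * \<alpha> = h * (\<rho> * \<beta>)" if "w \<in> I" for w
  proof -
    have "\<alpha> * quat_cnj w \<in> (*) \<beta> ` I"
      unfolding img[symmetric] using that by blast
    then obtain w' where w': "w' \<in> I" "\<alpha> * quat_cnj w = \<beta> * w'"
      by blast
    then have "quat_cnj w * \<alpha> = w' * \<beta>"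
      using commutant_commutative[of \<beta> w'] commutant_commutative[of \<alpha> "quat_cnj w"] w'(1) II \<alpha>(1) \<beta>(1)
        cnj_comm[OF that] by auto
    moreover obtain h where "h \<in> hurwitz" "w' = h * \<rho>"
      using w'(1) II by blast
    ultimately show ?thesis
      by (intro bexI[of _ h]) (simp_all add: mult.assoc)
  qed
  obtain h1 h2 where h: "h1 \<in> hurwitz" "a * \<beta> = h1 * (\<sigma> * \<alpha>)" "h2 \<in> hurwitz" "b * \<beta> = h2 * (\<sigma> * \<alpha>)"
    using to_\<sigma> uv(3,4) by blast
  define \<epsilon> where "\<epsilon> = u * h1 + v * h2"
  have \<epsilon>: "\<epsilon> \<in> hurwitz"
    using uv h by (simp add: \<epsilon>_def hurwitz_add hurwitz_mult)
  have \<rho>\<beta>: "\<rho> * \<beta> = \<epsilon> * (\<sigma> * \<alpha>)"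
    by (subst uv(5)) (simp add: \<epsilon>_def distrib_right mult.assoc h)
  obtain u' where u': "u' \<in> hurwitz" "\<tau> * u = u' * \<tau>" "u * \<tau> = \<tau> * u'"
    using face_diagonal_swap[OF \<tau>(1) uv(1)] .
  obtain v' where v': "v' \<in> hurwitz" "\<tau> * v = v' * \<tau>" "v * \<tau> = \<tau> * v'"
    using face_diagonal_swap[OF \<tau>(1) uv(2)] .
  obtain g1 g2 where g: "g1 \<in> hurwitz" "quat_cnj a * \<alpha> = g1 * (\<rho> * \<beta>)"
    "g2 \<in> hurwitz" "quat_cnj b * \<alpha> = g2 * (\<rho> * \<beta>)"
    using to_\<rho> uv(3,4) by blast
  \<comment> \<open>The Bezout identity for \<open>\<rho>\<close>, conjugated by
    \<open>\<tau>\<close>, expresses \<open>\<sigma>\<close> through conjugates of elements of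
    \<open>I\<close>.\<close>
  have "\<sigma> = (\<tau> * u) * a * inverse \<tau> + (\<tau> * v) * b * inverse \<tau>"
    unfolding \<sigma>_def uv(5) by (simp add: distrib_left distrib_right mult.assoc)
  also have "\<dots> = u' * quat_cnj a + v' * quat_cnj b"
    unfolding u'(2) v'(2) conj[OF uv(3), symmetric] conj[OF uv(4), symmetric] by (simp add: mult.assoc)
  finally have "\<sigma> * \<alpha> = (u' * g1 + v' * g2) * (\<rho> * \<beta>)"
    by (simp add: distrib_right mult.assoc g)
  moreover define \<epsilon>' where "\<epsilon>' = u' * g1 + v' * g2"
  ultimately have \<sigma>\<alpha>: "\<sigma> * \<alpha> = \<epsilon>' * (\<rho> * \<beta>)"
    by simp
  have \<epsilon>': "\<epsilon>' \<in> hurwitz"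
    using u' v' g by (simp add: \<epsilon>'_def hurwitz_add hurwitz_mult)
  have "\<rho> * \<beta> = (\<epsilon> * \<epsilon>') * (\<rho> * \<beta>)"
    using \<rho>\<beta> unfolding \<sigma>\<alpha> by (simp only: mult.assoc)
  moreover have "\<rho> * \<beta> \<noteq> 0"
    using \<rho>(2) \<beta>(2) by simp
  ultimately have "\<epsilon> * \<epsilon>' = 1"
    by (metis mult_1_left mult_right_cancel)
  then have "quat_norm \<epsilon> * quat_norm \<epsilon>' = 1"
    by (simp add: quat_norm_mult[symmetric]) (simp add: quat_norm_def one_quat_def)
  moreover obtain n n' where "quat_norm \<epsilon> = of_nat n" "quat_norm \<epsilon>' = of_nat n'"
    using hurwitz_norm_nat[OF \<epsilon>] hurwitz_norm_nat[OF \<epsilon>'] by metis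
  ultimately have "quat_norm \<epsilon> = 1"
    by (metis nat_mult_eq_1_iff of_nat_1 of_nat_eq_iff of_nat_mult)
  then have norm: "quat_norm (\<epsilon> * \<tau>) = 2"
    by (simp add: quat_norm_mult face_diagonal_norm[OF \<tau>(1)])
  \<comment> \<open>Chosen so that \<open>\<rho> * \<beta>\<close> is
    \<open>\<epsilon> * \<tau>\<close> times \<open>X\<close>. Right multiplication by
    \<open>\<mu>\<close> becomes left multiplication by \<open>k\<close> on
    \<open>\<rho> * \<beta>\<close>, but by \<open>- k\<close> on \<open>X\<close>, because the
    inverse of \<open>\<tau>\<close> anticommutes with \<open>\<mu>\<close>. Cancelling
    \<open>X\<close> leaves the claim.\<close>
  define X where "X = \<rho> * inverse \<tau> * \<alpha>"
  have X0: "X \<noteq> 0"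
    using \<rho>(2) \<tau>0 \<alpha>(2) by (simp add: X_def)
  have \<rho>X: "\<rho> * \<beta> = (\<epsilon> * \<tau>) * X"
    unfolding \<rho>\<beta> \<sigma>_def X_def by (simp add: mult.assoc)
  have "inverse \<tau> * (\<tau> * \<mu>) * inverse \<tau> = inverse \<tau> * (- (\<mu> * \<tau>)) * inverse \<tau>"
    by (simp add: \<tau>(2))
  then have inv: "inverse \<tau> * \<mu> = - (\<mu> * inverse \<tau>)"
    using \<tau>0 by (simp add: mult.assoc) (simp add: mult.assoc[symmetric])
  have "X * \<mu> = \<rho> * (inverse \<tau> * \<mu>) * \<alpha>"
    by (simp add: X_def mult.assoc \<alpha>(1))
  also have "\<dots> = - ((\<rho> * \<mu>) * inverse \<tau> * \<alpha>)"
    by (simp add: inv mult.assoc)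
  also have "\<dots> = - (k * X)"
    by (simp add: k X_def mult.assoc)
  finally have X\<mu>: "X * \<mu> = - (k * X)" .
  have "(k * (\<epsilon> * \<tau>)) * X = k * (\<rho> * \<beta>)"
    by (simp add: \<rho>X mult.assoc)
  also have "\<dots> = \<rho> * \<beta> * \<mu>"
    by (simp add: mult.assoc[symmetric] k[symmetric]) (simp add: mult.assoc \<beta>(1))
  also have "\<dots> = (- ((\<epsilon> * \<tau>) * k)) * X"
    unfolding \<rho>X by (simp add: mult.assoc X\<mu>)
  finally have "k * (\<epsilon> * \<tau>) = - ((\<epsilon> * \<tau>) * k)"
    using X0 by (metis mult_right_cancel)
  then show ?thesis
    using that[of "\<epsilon> * \<tau>"] norm hurwitz_mult[OF \<epsilon> face_diagonal_hurwitz[OF \<tau>(1)]] by simp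
qed

text \<open>Here \<open>cnj I = g \<cdot> I\<close> for the conjugate \<open>g\<close> of \<open>\<tau>\<^sup>-\<^sup>1 \<rho>\<^sup>-\<^sup>1 \<pi> \<rho>\<close>, which lies in the field of
  fractions of the order.\<close>

lemma equiv_if_anticommuting_face_diagonal:
  assumes \<rho>: "\<rho> \<in> hurwitz" "\<rho> \<noteq> 0"
    and \<tau>: "\<tau> \<in> face_diagonals" "\<tau> * \<mu> = - (\<mu> * \<tau>)"
    and \<pi>: "\<pi> \<in> face_diagonals" "\<pi> * k = - (k * \<pi>)"
    and k: "\<rho> * \<mu> = k * \<rho>"
  shows "ideal_equiv \<mu> (R_ideal \<mu> \<rho>) (quat_cnj ` R_ideal \<mu> \<rho>)"
proof -
  define I where "I = R_ideal \<mu> \<rho>"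
  have II: "w \<in> I \<longleftrightarrow> w * \<mu> = \<mu> * w \<and> (\<exists>h\<in>hurwitz. w = h * \<rho>)" for w
    unfolding I_def using R_ideal_iff[OF \<rho>(1)] .
  have nz: "\<tau> \<noteq> 0" "\<pi> \<noteq> 0"
    using face_diagonal_norm[OF \<tau>(1)] face_diagonal_norm[OF \<pi>(1)]
      quat_norm_eq_0_iff[of \<tau>] quat_norm_eq_0_iff[of \<pi>] by auto
  define \<gamma> where "\<gamma> = inverse \<tau> * (inverse \<rho> * (\<pi> * \<rho>))"
  define g where "g = quat_cnj \<gamma>"
  have \<rho>k: "inverse \<rho> * k = \<mu> * inverse \<rho>"
  proof -
    have "inverse \<rho> * (k * \<rho>) * inverse \<rho> = inverse \<rho> * (\<rho> * \<mu>) * inverse \<rho>"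
      by (simp add: k)
    then show ?thesis
      using \<rho>(2) by (simp add: mult.assoc) (simp add: mult.assoc[symmetric])
  qed
  \<comment> \<open>Conjugating \<open>\<pi>\<close> back by \<open>\<rho>\<close> gives an element
    anticommuting with \<open>\<mu>\<close>. As \<open>\<tau>\<close> anticommutes with
    \<open>\<mu>\<close> too, the quotient \<open>\<gamma>\<close> commutes with it.\<close>
  have "\<tau> * (\<gamma> * \<mu>) = inverse \<rho> * (\<pi> * k) * \<rho>"
    using nz by (simp add: \<gamma>_def mult.assoc k mult.assoc[of \<tau> "inverse \<tau>", symmetric])
  also have "\<dots> = - ((inverse \<rho> * k) * \<pi> * \<rho>)"
    by (simp add: \<pi>(2) mult.assoc)
  also have "\<dots> = - (\<mu> * (\<tau> * \<gamma>))"
    using nz by (simp add: \<rho>k \<gamma>_def mult.assoc mult.assoc[of \<tau> "inverse \<tau>", symmetric])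
  also have "\<dots> = \<tau> * (\<mu> * \<gamma>)"
    by (simp add: mult.assoc[symmetric] \<tau>(2))
  finally have \<gamma>: "\<gamma> * \<mu> = \<mu> * \<gamma>"
    using nz by simp
  have g: "g * \<mu> = \<mu> * g"
    using commute_cnj \<gamma> unfolding g_def mu by blast
  have g\<tau>: "\<tau> * \<gamma> = g * \<tau>"
    using anticommuting_cnj[OF \<tau>(2) \<gamma>] by (simp add: g_def)
  have "\<pi> * \<rho> = \<rho> * (\<tau> * \<gamma>)"
    using nz \<rho>(2) by (simp add: \<gamma>_def mult.assoc[symmetric])
  then have \<pi>\<rho>: "\<pi> * \<rho> = \<rho> * g * \<tau>"
    by (simp add: g\<tau> mult.assoc)
  have "\<gamma> \<noteq> 0"
    using nz \<rho>(2) by (simp add: \<gamma>_def)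
  then have g0: "g \<noteq> 0"
    by (metis g_def quat_norm_cnj quat_norm_eq_0_iff)
  have conj: "\<tau> * w = quat_cnj w * \<tau>" if "w * \<mu> = \<mu> * w" for w
    using anticommuting_cnj[OF \<tau>(2) that] .
  have cnjI: "quat_cnj ` I = (*) g ` I"
  proof (intro equalityI subsetI)
    fix w
    assume "w \<in> quat_cnj ` I"
    then obtain y h where y: "w = quat_cnj y" "y * \<mu> = \<mu> * y" "h \<in> hurwitz" "y = h * \<rho>"
      using II by blast
    obtain h' where h': "h' \<in> hurwitz" "\<tau> * h = h' * \<tau>" "h * \<tau> = \<tau> * h'"
      using face_diagonal_swap[OF \<tau>(1) y(3)] .
    \<comment> \<open>Trading \<open>\<tau>\<close> for \<open>\<pi>\<close> makes
      \<open>\<pi>\<rho>\<close> applicable, which moves the diagonal past \<open>\<rho>\<close> at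
      the cost of the factor \<open>g\<close>.\<close>
    obtain e where e: "e \<in> hurwitz" "\<tau> = e * \<pi>"
      using face_diagonals_associated[OF \<tau>(1) \<pi>(1)] .
    have "w * \<tau> = h' * \<tau> * \<rho>"
      using conj[OF y(2)] h'(2) by (simp add: y(1)) (simp add: y(4) mult.assoc[symmetric])
    also have "\<dots> = h' * e * (\<pi> * \<rho>)"
      by (simp add: e(2) mult.assoc)
    also have "\<dots> = (h' * e * \<rho> * g) * \<tau>"
      by (simp add: \<pi>\<rho> mult.assoc)
    finally have w: "w = h' * e * \<rho> * g"
      using nz by simp
    have wc: "w * \<mu> = \<mu> * w"
      using commute_cnj y(2) unfolding y(1) mu by blast
    have "h' * e * \<rho> = w * inverse g"
      using g0 by (simp add: w mult.assoc)
    then have c: "(h' * e * \<rho>) * \<mu> = \<mu> * (h' * e * \<rho>)"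
      using commute_mult[OF wc commute_inverse[OF g g0]] by simp
    then have "h' * e * \<rho> \<in> I"
      using II h'(1) e(1) hurwitz_mult by blast
    moreover have "w = g * (h' * e * \<rho>)"
      using w commutant_commutative[OF c g] by simp
    ultimately show "w \<in> (*) g ` I"
      by blast
  next
    fix w
    assume "w \<in> (*) g ` I"
    then obtain y h where y: "w = g * y" "y * \<mu> = \<mu> * y" "h \<in> hurwitz" "y = h * \<rho>"
      using II by blast
    obtain e where e: "e \<in> hurwitz" "\<pi> = e * \<tau>"
      using face_diagonals_associated[OF \<pi>(1) \<tau>(1)] .
    obtain h' where h': "h' \<in> hurwitz" "\<tau> * (h * e) = h' * \<tau>" "(h * e) * \<tau> = \<tau> * h'"
      using face_diagonal_swap[OF \<tau>(1) hurwitz_mult[OF y(3) e(1)]] .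
    have wc: "w * \<mu> = \<mu> * w"
      unfolding y(1) using commute_mult[OF g y(2)] .
    then have wc': "quat_cnj w * \<mu> = \<mu> * quat_cnj w"
      using commute_cnj unfolding mu by blast
    have "\<tau> * quat_cnj w = w * \<tau>"
      using conj[OF wc'] by simp
    also have "\<dots> = h * (\<rho> * g * \<tau>)"
      unfolding y(1) commutant_commutative[OF g y(2)] by (simp add: y(4) mult.assoc)
    also have "\<dots> = ((h * e) * \<tau>) * \<rho>"
      unfolding \<pi>\<rho>[symmetric] by (simp add: e(2) mult.assoc)
    also have "\<dots> = \<tau> * (h' * \<rho>)"
      unfolding h'(3) by (simp add: mult.assoc)
    finally have "quat_cnj w = h' * \<rho>"
      using nz by simp
    then have "quat_cnj w \<in> I"
      using II wc' h'(1) by blast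
    then show "w \<in> quat_cnj ` I"
      by (metis image_eqI quat_cnj_cnj)
  qed
  obtain n where n: "quat_norm \<rho> = of_nat n"
    using hurwitz_norm_nat[OF \<rho>(1)] .
  \<comment> \<open>Twice the norm of \<open>\<rho>\<close> clears the denominators of
    \<open>\<gamma>\<close>: 2 for the inverse of \<open>\<tau>\<close> and the norm for the inverse
    of \<open>\<rho>\<close>. So \<open>N * g\<close> and \<open>N\<close> are multipliers inside
    the order.\<close>
  define N :: quat where "N = of_nat (2 * n)"
  have N: "N = Quat (2 * quat_norm \<rho>) 0 0 0"
    by (simp only: N_def of_nat_quat n) simp
  have N0: "N \<noteq> 0"
    using \<rho>(2) quat_norm_eq_0_iff[of \<rho>] by (simp add: N zero_quat_def)
  have Nc: "N * p = p * N" for p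
    by (simp add: N times_quat_def)
  have "inverse \<tau> * (\<tau> * \<tau>) = inverse \<tau> * (- 2)"
    by (simp only: face_diagonal_square[OF \<tau>(1)])
  then have "\<tau> = - (2 * inverse \<tau>)"
    using nz by (simp add: mult.assoc[symmetric] mult_2 mult_2_right)
  then have \<tau>2: "2 * inverse \<tau> = - \<tau>"
    by (metis minus_minus)
  have \<rho>n: "Quat (quat_norm \<rho>) 0 0 0 * inverse \<rho> = quat_cnj \<rho>"
    using \<rho>(2) by (simp add: quat_cnj_mult_self[symmetric] mult.assoc)
  have "N = 2 * Quat (quat_norm \<rho>) 0 0 0"
    by (simp add: N numeral_quat times_quat_def)
  moreover have "Quat r 0 0 0 * p = p * Quat r 0 0 0" for r p
    by (simp add: times_quat_def)
  ultimately have "N * \<gamma> = (2 * inverse \<tau>) * ((Quat (quat_norm \<rho>) 0 0 0 * inverse \<rho>) * (\<pi> * \<rho>))"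
    unfolding \<gamma>_def by (metis mult.assoc)
  then have "N * \<gamma> \<in> hurwitz"
    unfolding \<tau>2 \<rho>n using hurwitz_mult hurwitz_cnj \<rho>(1) face_diagonal_hurwitz \<tau>(1) \<pi>(1)
      hurwitz_diff[OF hurwitz_0] by simp
  moreover have "quat_cnj (N * \<gamma>) = N * g"
  proof -
    have "quat_cnj N = N"
      by (simp add: N quat_cnj_def)
    then show ?thesis
      using Nc by (simp add: quat_cnj_mult g_def)
  qed
  ultimately have "N * g \<in> hurwitz"
    using hurwitz_cnj by metis
  moreover have "(N * g) * \<mu> = \<mu> * (N * g)"
    using commute_mult[OF Nc g] .
  ultimately have "N * g \<in> quad_order \<mu> - {0}"
    using N0 g0 by (simp add: quad_order_eq)
  moreover have "N \<in> quad_order \<mu> - {0}"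
    using N0 Nc hurwitz_of_int[of "int (2 * n)"] by (simp add: quad_order_eq N_def)
  moreover have "(*) (N * g) ` I = (*) N ` quat_cnj ` I"
    unfolding cnjI by (simp add: image_image mult.assoc)
  ultimately show ?thesis
    unfolding ideal_equiv_def I_def by blast
qed

end

theorem theorem7:
  fixes \<mu> \<rho> :: quat and x0 y0 z0 x1 y1 z1 :: real and m :: nat
  assumes "\<mu> = Quat 0 x0 y0 z0"
    and "\<mu> \<in> hurwitz"
    and "quat_norm \<mu> = of_nat m"
    and "squarefree m"
    and "exactly_two_abs_eq x0 y0 z0"
    and "nonzero_ideal \<mu> (R_ideal \<mu> \<rho>)"
    and "right_pseudo_generator \<mu> (R_ideal \<mu> \<rho>) \<rho>"
    and "\<rho> * \<mu> * inverse \<rho> = Quat 0 x1 y1 z1"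
  shows "ambiguous_class \<mu> (R_ideal \<mu> \<rho>) \<longleftrightarrow> exactly_two_abs_eq x1 y1 z1"
proof -
  obtain x y z :: int where xyz: "\<mu> = Quat 0 (of_int x) (of_int y) (of_int z)"
    using pure_hurwitz_int[OF assms(2)] assms(1) by auto
  have "real_of_int (x\<^sup>2 + y\<^sup>2 + z\<^sup>2) = of_int (int m)"
    using assms(3) by (simp add: xyz quat_norm_def)
  then have sum: "x\<^sup>2 + y\<^sup>2 + z\<^sup>2 = int m"
    unfolding of_int_eq_iff .
  interpret squarefree_pure \<mu> x y z m
    using xyz sum assms(4) by unfold_locales
  let ?k = "Quat 0 x1 y1 z1"
  obtain \<rho>: "\<rho> \<in> hurwitz" "\<rho> \<noteq> 0"
    using right_pseudo_generator_bezout[OF assms(7)] by metis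
  have k: "\<rho> * \<mu> = ?k * \<rho>"
    using \<rho>(2) by (simp add: assms(8)[symmetric] mult.assoc)
  have k0: "?k \<noteq> 0"
    using k \<rho>(2) mu_nonzero by auto
  obtain \<tau> where "\<tau> \<in> face_diagonals" "qI \<tau> * x0 + qJ \<tau> * y0 + qK \<tau> * z0 = 0"
    using exists_orthogonal_face_diagonal_iff[of x0 y0 z0] assms(5)
    unfolding exactly_two_abs_eq_def by blast
  then have \<tau>: "\<tau> \<in> face_diagonals" "\<tau> * \<mu> = - (\<mu> * \<tau>)"
    using anticommute_pure_iff[of x0 y0 z0 \<tau>] mu_nonzero
    unfolding assms(1) by (auto simp: face_diagonals_def)
  have not_all: "\<not> (\<bar>x1\<bar> = \<bar>y1\<bar> \<and> \<bar>x1\<bar> = \<bar>z1\<bar>)"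
  proof
    assume eq: "\<bar>x1\<bar> = \<bar>y1\<bar> \<and> \<bar>x1\<bar> = \<bar>z1\<bar>"
    have "?k \<in> hurwitz" "qRe ?k = 0"
      using conjugate_hurwitz[OF assms(6,7)] by (simp_all add: assms(8))
    from pure_hurwitz_int[OF this] obtain a b c :: int
      where "?k = Quat 0 (of_int a) (of_int b) (of_int c)" .
    then have abc: "x1 = of_int a" "y1 = of_int b" "z1 = of_int c"
      by simp_all
    have "quat_norm \<mu> * quat_norm \<rho> = quat_norm ?k * quat_norm \<rho>"
      using arg_cong[OF k, of quat_norm] by (simp add: quat_norm_mult mult.commute)
    then have "quat_norm ?k = of_nat m"
      using \<rho>(2) assms(3) quat_norm_eq_0_iff[of \<rho>] by simp
    moreover have "y1\<^sup>2 = x1\<^sup>2" "z1\<^sup>2 = x1\<^sup>2"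
      using eq by (metis power2_abs)+
    ultimately have "real_of_int (3 * a\<^sup>2) = of_int (int m)"
      by (simp add: quat_norm_def abc)
    then have m3: "3 * a\<^sup>2 = int m"
      unfolding of_int_eq_iff .
    then have "int m = int (3 * (nat \<bar>a\<bar>)\<^sup>2)"
      by simp
    then have m3': "m = 3 * (nat \<bar>a\<bar>)\<^sup>2"
      unfolding of_nat_eq_iff .
    \<comment> \<open>The square of \<open>a\<close> divides the squarefree
      \<open>m\<close>.\<close>
    then have "nat \<bar>a\<bar> dvd 1"
      using squarefreeD[OF assms(4), of "nat \<bar>a\<bar>"] dvd_triv_right[of "(nat \<bar>a\<bar>)\<^sup>2" 3]
      unfolding m3'[symmetric] by blast
    then have "nat \<bar>a\<bar> = 1"
      by simp
    then have "m = 3"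
      unfolding m3' by simp
    \<comment> \<open>Three odd squares with sum 3 are all 1, so all coordinates of
      \<open>\<mu>\<close> would agree in absolute value.\<close>
    have "\<bar>x\<bar> = \<bar>y\<bar> \<and> \<bar>x\<bar> = \<bar>z\<bar>"
    proof -
      have "odd x" "odd y" "odd z"
        using mod_4_eq_3_iff \<open>m = 3\<close> by auto
      then have "x\<^sup>2 \<ge> 1" "y\<^sup>2 \<ge> 1" "z\<^sup>2 \<ge> 1"
        by (auto simp: int_one_le_iff_zero_less)
      then have "x\<^sup>2 = 1" "y\<^sup>2 = 1" "z\<^sup>2 = 1"
        using sum \<open>m = 3\<close> by simp_all
      then show ?thesis
        by (auto simp: power2_eq_1_iff)
    qed
    then have "\<bar>x0\<bar> = \<bar>y0\<bar> \<and> \<bar>x0\<bar> = \<bar>z0\<bar>"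
      using assms(1) xyz by (metis of_int_abs quat.inject)
    then show False
      using assms(5) unfolding exactly_two_abs_eq_def by auto
  qed
  \<comment> \<open>By \<open>not_all\<close>, "exactly two" amounts to "some two" for the
    coordinates of the conjugate.\<close>
  have "ideal_equiv \<mu> (R_ideal \<mu> \<rho>) (quat_cnj ` R_ideal \<mu> \<rho>) \<longleftrightarrow>
    \<bar>x1\<bar> = \<bar>y1\<bar> \<or> \<bar>x1\<bar> = \<bar>z1\<bar> \<or> \<bar>y1\<bar> = \<bar>z1\<bar>"
  proof
    assume "ideal_equiv \<mu> (R_ideal \<mu> \<rho>) (quat_cnj ` R_ideal \<mu> \<rho>)"
    from anticommuting_norm_2_if_equiv[OF assms(7) \<tau> ideal_equiv_sym[OF this] k] obtain q
      where "q \<in> hurwitz" "quat_norm q = 2" "q * ?k = - (?k * q)" .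
    then show "\<bar>x1\<bar> = \<bar>y1\<bar> \<or> \<bar>x1\<bar> = \<bar>z1\<bar> \<or> \<bar>y1\<bar> = \<bar>z1\<bar>"
      using orthogonal_norm_2_abs_eq anticommute_pure_iff[OF k0] by blast
  next
    assume "\<bar>x1\<bar> = \<bar>y1\<bar> \<or> \<bar>x1\<bar> = \<bar>z1\<bar> \<or> \<bar>y1\<bar> = \<bar>z1\<bar>"
    then obtain \<pi> where "\<pi> \<in> face_diagonals" "qI \<pi> * x1 + qJ \<pi> * y1 + qK \<pi> * z1 = 0"
      using exists_orthogonal_face_diagonal_iff by blast
    then have \<pi>: "\<pi> \<in> face_diagonals" "\<pi> * ?k = - (?k * \<pi>)"
      unfolding anticommute_pure_iff[OF k0] by (auto simp: face_diagonals_def)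
    show "ideal_equiv \<mu> (R_ideal \<mu> \<rho>) (quat_cnj ` R_ideal \<mu> \<rho>)"
      using equiv_if_anticommuting_face_diagonal[OF \<rho> \<tau> \<pi> k] .
  qed
  then show ?thesis
    unfolding ambiguous_class_iff[OF assms(6)] using not_all by (auto simp: exactly_two_abs_eq_def)
qed

end
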